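(* Let $\Omega\subset\mathbb{R}^n$, $n\ge1$, be a domain, let $p>n$, let $f\in W^{1,p}(\Omega:\mathbb{R}^N)$ be a continuous map, and let $E\subset\Omega$ be compact. Then $$\overline{\dim}_\theta f(E)\le\frac{p\,\overline{\dim}_\theta E}{p-n+\overline{\dim}_\theta E}\qquad\text{for all }0<\theta<1.$$
   Context: $W^{1,p}(\Omega:\mathbb{R}^N)$ is the Sobolev space of maps $f=(f_1,\dots,f_N)$ with each $f_j\in W^{1,p}(\Omega)$. For a bounded set $A\subset\mathbb{R}^k$ and $0<\theta<1$, the upper $\theta$-intermediate dimension $\overline{\dim}_\theta A$ is the infimum of those $s>0$ such that for each $\epsilon>0$ there exists $\delta_0>0$ so that for each $0<\delta\le\delta_0$ there is a countable covering $(A_i)$ of $A$ by subsets of $\mathbb{R}^k$ with $\delta^{1/\theta}\le\operatorname{diam}(A_i)\le\delta$ for all $i$ and $\sum_i(\operatorname{diam}A_i)^s<\epsilon$. *)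

theory Defs
  imports "HOL-Analysis.Analysis"
begin

text \<open>
  Differentiability classes on an open set, by recursion on the order: all directional derivatives
  are required to be of the next lower class. On a Euclidean space this is equivalent to the
  existence and continuity of all iterated partial derivatives up to order \<open>k\<close>.
\<close>

fun Ck_on :: "nat \<Rightarrow> 'a::euclidean_space set \<Rightarrow> ('a \<Rightarrow> real) \<Rightarrow> bool" where
  "Ck_on 0 S \<phi> \<longleftrightarrow> continuous_on S \<phi>"
| "Ck_on (Suc k) S \<phi> \<longleftrightarrow>
     (\<forall>x\<in>S. \<phi> differentiable (at x)) \<and>
     (\<forall>v. Ck_on k S (\<lambda>x. frechet_derivative \<phi> (at x) v))"

definition test_functions :: "'a::euclidean_space set \<Rightarrow> ('a \<Rightarrow> real) set" where
  "test_functions \<Omega> =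
     {\<phi>. (\<forall>k. Ck_on k UNIV \<phi>) \<and> compact (closure {x. \<phi> x \<noteq> 0}) \<and> closure {x. \<phi> x \<noteq> 0} \<subseteq> \<Omega>}"

text \<open>
  Functions are total, but only their values on \<open>\<Omega>\<close> enter the definitions below. Elements of
  \<open>L\<^sup>p(\<Omega>)\<close> and of the Sobolev spaces are functions rather than classes modulo null sets.
\<close>

definition Lp_on :: "real \<Rightarrow> 'a::euclidean_space set \<Rightarrow> ('a \<Rightarrow> real) set" where
  "Lp_on p \<Omega> = {u. u \<in> borel_measurable (lebesgue_on \<Omega>) \<and>
                    integrable (lebesgue_on \<Omega>) (\<lambda>x. \<bar>u x\<bar> powr p)}"

text \<open>
  \<open>g\<close> is a weak derivative of \<open>u\<close> on \<open>\<Omega>\<close> in direction \<open>e\<close>. The Bochner integral of a non-integrable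
  function is \<open>0\<close> by convention, so this is meant for locally integrable \<open>u\<close> and \<open>g\<close>, for which both
  integrands are integrable.
\<close>

definition weak_derivative ::
  "'a::euclidean_space set \<Rightarrow> 'a \<Rightarrow> ('a \<Rightarrow> real) \<Rightarrow> ('a \<Rightarrow> real) \<Rightarrow> bool" where
  "weak_derivative \<Omega> e u g \<longleftrightarrow>
     (\<forall>\<phi>\<in>test_functions \<Omega>.
        (LINT x|lebesgue_on \<Omega>. u x * frechet_derivative \<phi> (at x) e) =
        - (LINT x|lebesgue_on \<Omega>. g x * \<phi> x))"

definition sobolev_W1 :: "real \<Rightarrow> 'a::euclidean_space set \<Rightarrow> ('a \<Rightarrow> real) set" where
  "sobolev_W1 p \<Omega> =
     {u \<in> Lp_on p \<Omega>. \<forall>e\<in>Basis. \<exists>g\<in>Lp_on p \<Omega>. weak_derivative \<Omega> e u g}"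

definition sobolev_W1_map ::
  "real \<Rightarrow> 'a::euclidean_space set \<Rightarrow> ('a \<Rightarrow> real ^ 'm) set" where
  "sobolev_W1_map p \<Omega> = {f. \<forall>j. (\<lambda>x. f x $ j) \<in> sobolev_W1 p \<Omega>}"

text \<open>
  Coverings are families indexed by a subset of \<open>\<nat>\<close>, so that finite families are allowed (and in
  fact forced by the lower bound on the diameters). Boundedness of the covering sets is stated
  explicitly because \<^const>\<open>diameter\<close> is real-valued and has no meaningful value on unbounded
  sets. Likewise \<^const>\<open>infsum\<close> is \<open>0\<close> on families that are not summable, hence the
  summability condition.
\<close>

definition theta_cover ::
  "real \<Rightarrow> real \<Rightarrow> 'a::metric_space set \<Rightarrow> nat set \<Rightarrow> (nat \<Rightarrow> 'a set) \<Rightarrow> bool" where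
  "theta_cover \<theta> \<delta> A I C \<longleftrightarrow>
     A \<subseteq> (\<Union>i\<in>I. C i) \<and>
     (\<forall>i\<in>I. bounded (C i) \<and> \<delta> powr (1 / \<theta>) \<le> diameter (C i) \<and> diameter (C i) \<le> \<delta>)"

text \<open>
  For bounded \<open>A\<close> in a Euclidean space of dimension \<open>k \<ge> 1\<close> the set below contains every \<open>s > k\<close>,
  so the infimum is that of a non-empty set bounded below by \<open>0\<close>.
\<close>

definition upper_intermediate_dim :: "real \<Rightarrow> 'a::euclidean_space set \<Rightarrow> real" where
  "upper_intermediate_dim \<theta> A =
     Inf {s. s > 0 \<and>
       (\<forall>\<epsilon>>0. \<exists>\<delta>0>0. \<forall>\<delta>. 0 < \<delta> \<and> \<delta> \<le> \<delta>0 \<longrightarrow>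
          (\<exists>I C. theta_cover \<theta> \<delta> A I C \<and>
             (\<lambda>i. diameter (C i) powr s) summable_on I \<and>
             (\<Sum>\<^sub>\<infinity>i\<in>I. diameter (C i) powr s) < \<epsilon>))}"

end

theory Submission
  imports Defs
begin

text \<open>
  Morrey's inequality bounds the oscillation of \<open>f\<close> on a cube \<open>Q\<close> of side \<open>l\<close> by
  \<open>C l\<^sup>\<gamma> a(Q) powr (1/p)\<close> with \<open>\<gamma> = 1 - n/p\<close> and \<open>a(Q)\<close> the integral of \<open>1 + |Df|\<close> to the
  power \<open>p\<close> over \<open>Q\<close>; at each dyadic level the sum of the \<open>a(Q)\<close> is bounded.
  It is proved directly from the weak derivative: the average of \<open>u (x + s (w - x))\<close> against a fixed
  bump \<open>b(w)\<close> tends to a multiple of \<open>u x\<close> as \<open>s \<rightarrow> 0\<close>, does not depend on \<open>x\<close> at \<open>s = 1\<close>, and its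
  derivative in \<open>s\<close> is the weak derivative of \<open>u\<close> tested against explicit smooth functions.

  Now let \<open>s\<close> be admissible for \<open>E\<close> and put \<open>\<alpha> = (p - n + s)/p\<close>, \<open>t = s/\<alpha>\<close>. A cover of \<open>E\<close> at scale \<open>\<delta>\<close> is
  replaced by dyadic cubes of comparable size, and \<open>f(E)\<close> is covered at scale \<open>\<delta>' = \<delta> powr \<alpha>\<close>.
  Cubes whose image is too large for \<open>\<delta>'\<close> are subdivided until the images fit. There are only
  \<open>O(\<delta> powr (-s))\<close> cubes to be subdivided at all levels together, and each of their children costs at
  most \<open>\<delta>' powr t' = \<delta> powr (\<alpha> t')\<close>, while the remaining cubes are controlled by Young's inequality
  \<open>l powr (\<gamma> t) a(Q) powr (t/p) \<le> l powr s + a(Q)\<close>. So every \<open>t' > t\<close> is admissible for \<open>f(E)\<close>.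
\<close>

subsection \<open>A smooth bump on the unit cube\<close>

lemma Ck_on_SucI:
  assumes "\<And>x. (\<phi> has_derivative \<phi>' x) (at x)" and "\<And>v. Ck_on k UNIV (\<lambda>x. \<phi>' x v)"
  shows "Ck_on (Suc k) UNIV \<phi>"
proof -
  have "frechet_derivative \<phi> (at x) = \<phi>' x" for x
    using frechet_derivative_at[OF assms(1)] by simp
  then show ?thesis
    using assms by (auto simp: differentiable_def)
qed

lemma Ck_on_Suc_has_derivative:
  assumes "Ck_on (Suc k) UNIV \<phi>"
  shows "(\<phi> has_derivative frechet_derivative \<phi> (at x)) (at x)"
  using assms frechet_derivative_works by auto

text \<open>Needed for the product rule, where an undifferentiated factor meets an induction
  hypothesis of lower order.\<close>

lemma Ck_on_Suc_imp: "Ck_on (Suc k) UNIV \<phi> \<Longrightarrow> Ck_on k UNIV \<phi>"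
proof (induction k arbitrary: \<phi>)
  case 0
  then show ?case
    by (auto simp: continuous_on_eq_continuous_at intro: differentiable_imp_continuous_within)
next
  case (Suc k)
  then have "Ck_on (Suc k) UNIV (\<lambda>x. frechet_derivative \<phi> (at x) v)" for v
    by simp
  then have "Ck_on k UNIV (\<lambda>x. frechet_derivative \<phi> (at x) v)" for v
    using Suc.IH by blast
  with Suc.prems show ?case
    by simp
qed

lemma Ck_on_const: "Ck_on k UNIV (\<lambda>x. c)"
proof (induction k arbitrary: c)
  case (Suc k)
  show ?case
    by (rule Ck_on_SucI[where \<phi>' = "\<lambda>x v. 0"]) (auto intro: Suc.IH)
qed simp

lemma Ck_on_add:
  "Ck_on k UNIV \<phi> \<Longrightarrow> Ck_on k UNIV \<psi> \<Longrightarrow> Ck_on k UNIV (\<lambda>x. \<phi> x + \<psi> x)"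
proof (induction k arbitrary: \<phi> \<psi>)
  case 0
  then show ?case by (auto intro!: continuous_intros)
next
  case (Suc k)
  show ?case
  proof (rule Ck_on_SucI)
    show "((\<lambda>x. \<phi> x + \<psi> x) has_derivative
        (\<lambda>v. frechet_derivative \<phi> (at x) v + frechet_derivative \<psi> (at x) v)) (at x)" for x
      by (intro has_derivative_add Ck_on_Suc_has_derivative[OF Suc.prems(1)]
          Ck_on_Suc_has_derivative[OF Suc.prems(2)])
    show "Ck_on k UNIV (\<lambda>x. frechet_derivative \<phi> (at x) v + frechet_derivative \<psi> (at x) v)" for v
      using Suc.prems by (intro Suc.IH) auto
  qed
qed

lemma Ck_on_mult:
  "Ck_on k UNIV \<phi> \<Longrightarrow> Ck_on k UNIV \<psi> \<Longrightarrow> Ck_on k UNIV (\<lambda>x. \<phi> x * \<psi> x)"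
proof (induction k arbitrary: \<phi> \<psi>)
  case 0
  then show ?case by (auto intro!: continuous_intros)
next
  case (Suc k)
  show ?case
  proof (rule Ck_on_SucI)
    show "((\<lambda>x. \<phi> x * \<psi> x) has_derivative
        (\<lambda>v. \<phi> x * frechet_derivative \<psi> (at x) v + frechet_derivative \<phi> (at x) v * \<psi> x)) (at x)" for x
      by (intro has_derivative_mult Ck_on_Suc_has_derivative[OF Suc.prems(1)]
          Ck_on_Suc_has_derivative[OF Suc.prems(2)])
    show "Ck_on k UNIV (\<lambda>x. \<phi> x * frechet_derivative \<psi> (at x) v
        + frechet_derivative \<phi> (at x) v * \<psi> x)" for v
      using Suc.prems Suc.prems[THEN Ck_on_Suc_imp] by (intro Ck_on_add Suc.IH) auto
  qed
qed

lemma Ck_on_prod: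
  assumes "\<And>i. i \<in> I \<Longrightarrow> Ck_on k UNIV (\<phi> i)"
  shows "Ck_on k UNIV (\<lambda>x. \<Prod>i\<in>I. \<phi> i x)"
  using assms
proof (induction I rule: infinite_finite_induct)
  case (insert i I)
  then show ?case
    by (auto simp: insert(1,2) intro!: Ck_on_mult)
qed (auto intro: Ck_on_const)

lemma Ck_on_inner: "Ck_on k UNIV (\<lambda>x. x \<bullet> a)"
proof (cases k)
  case 0
  then show ?thesis by (auto intro!: continuous_intros)
next
  case (Suc m)
  show ?thesis
    unfolding Suc
    by (rule Ck_on_SucI[where \<phi>' = "\<lambda>x v. v \<bullet> a"]) (auto intro: Ck_on_const derivative_eq_intros)
qed

lemma Ck_on_affine:
  "Ck_on k UNIV \<phi> \<Longrightarrow> Ck_on k UNIV (\<lambda>x. \<phi> (c *\<^sub>R x + d))"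
proof (induction k arbitrary: \<phi>)
  case 0
  then show ?case
    by (auto intro!: continuous_on_compose2[where f = "\<lambda>x. c *\<^sub>R x + d" and t = UNIV] continuous_intros)
next
  case (Suc k)
  show ?case
  proof (rule Ck_on_SucI)
    show "((\<lambda>x. \<phi> (c *\<^sub>R x + d)) has_derivative
        (\<lambda>v. frechet_derivative \<phi> (at (c *\<^sub>R x + d)) (c *\<^sub>R v))) (at x)" for x
      by (rule has_derivative_compose[OF _ Ck_on_Suc_has_derivative[OF Suc.prems]])
        (auto intro!: derivative_eq_intros)
    show "Ck_on k UNIV (\<lambda>x. frechet_derivative \<phi> (at (c *\<^sub>R x + d)) (c *\<^sub>R v))" for v
      using Suc.prems by (intro Suc.IH[where \<phi> = "\<lambda>y. frechet_derivative \<phi> (at y) (c *\<^sub>R v)"]) simp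
  qed
qed

text \<open>The functions \<open>q(1/t) exp(-1/t)\<close>, \<open>q\<close> a polynomial, form a class closed under derivatives.\<close>

definition exp_flat :: "real poly \<Rightarrow> real \<Rightarrow> real" where
  "exp_flat q t = (if t > 0 then poly q (1 / t) * exp (- (1 / t)) else 0)"

text \<open>In the variable \<open>x = 1 / t\<close> this says that \<open>exp (- x)\<close> beats
  every polynomial at infinity.\<close>

lemma exp_flat_tendsto_0: "(exp_flat q \<longlongrightarrow> 0) (at_right 0)"
proof -
  have mono: "((\<lambda>x. x ^ k * exp (- x)) \<longlongrightarrow> (0::real)) at_top" for k
    using tendsto_power_div_exp_0[of k] by (simp add: exp_minus divide_inverse)
  \<comment> \<open>The extra power \<open>x ^ k\<close> carries the induction over the
    coefficients: \<open>pCons\<close> multiplies the remaining polynomial by \<open>x\<close>,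
    which is absorbed by passing from \<open>k\<close> to \<open>Suc k\<close>.\<close>
  have "((\<lambda>x. x ^ k * (poly q x * exp (- x))) \<longlongrightarrow> 0) at_top" for k
  proof (induction q arbitrary: k)
    case (pCons a q)
    have "((\<lambda>x. a * (x ^ k * exp (- x)) + x ^ Suc k * (poly q x * exp (- x))) \<longlongrightarrow> a * 0 + 0) at_top"
      by (intro tendsto_intros mono pCons.IH)
    then show ?case
      by (simp add: algebra_simps)
  qed simp
  from this[of 0] have "((\<lambda>x. poly q x * exp (- x)) \<longlongrightarrow> 0) at_top" by simp
  from filterlim_compose[OF this filterlim_inverse_at_top_right]
  have "((\<lambda>t. poly q (inverse t) * exp (- inverse t)) \<longlongrightarrow> 0) (at_right 0)" .
  then show ?thesis
    by (rule Lim_transform_eventually)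
      (auto simp: eventually_at_filter exp_flat_def inverse_eq_divide)
qed

text \<open>For \<open>t > 0\<close> the derivative is \<open>(1 / t)\<^sup>2\<close> times
  \<open>q - pderiv q\<close> at \<open>1 / t\<close>, times the exponential; the two
  \<open>pCons 0\<close> encode the factor \<open>(1 / t)\<^sup>2\<close>.\<close>

lemma exp_flat_DERIV:
  "(exp_flat q has_real_derivative exp_flat (pCons 0 (pCons 0 (q - pderiv q))) t) (at t)"
proof -
  consider "t > 0" | "t < 0" | "t = 0" by linarith
  then show ?thesis
  proof cases
    case 1
    have "((\<lambda>t. poly q (1 / t) * exp (- (1 / t))) has_real_derivative
        exp_flat (pCons 0 (pCons 0 (q - pderiv q))) t) (at t)"
      using 1 by (auto intro!: derivative_eq_intros poly_DERIV[THEN DERIV_chain2]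
          simp: exp_flat_def field_simps power2_eq_square)
    then show ?thesis
      by (rule has_field_derivative_transform_within_open[where S = "{0<..}"])
        (use 1 in \<open>auto simp: exp_flat_def\<close>)
  next
    case 2
    have "((\<lambda>t. 0) has_real_derivative exp_flat (pCons 0 (pCons 0 (q - pderiv q))) t) (at t)"
      using 2 by (auto simp: exp_flat_def)
    then show ?thesis
      by (rule has_field_derivative_transform_within_open[where S = "{..<0}"])
        (use 2 in \<open>auto simp: exp_flat_def\<close>)
  next
    case 3
    \<comment> \<open>To the right of 0 the difference quotient is itself of the class, with
      polynomial \<open>pCons 0 q\<close>, so the limit just proved applies.\<close>
    have "((\<lambda>t. (exp_flat q t - exp_flat q 0) / (t - 0)) \<longlongrightarrow> 0) (at_right 0)"
      by (rule Lim_transform_eventually[OF exp_flat_tendsto_0[of "pCons 0 q"]])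
        (auto simp: eventually_at_filter exp_flat_def)
    moreover have "((\<lambda>t. (exp_flat q t - exp_flat q 0) / (t - 0)) \<longlongrightarrow> 0) (at_left 0)"
      by (rule Lim_transform_eventually[OF tendsto_const])
        (auto simp: eventually_at_filter exp_flat_def)
    ultimately have "((\<lambda>t. (exp_flat q t - exp_flat q 0) / (t - 0)) \<longlongrightarrow> 0) (at 0)"
      by (simp add: filterlim_split_at)
    then show ?thesis
      using 3 by (simp add: has_field_derivative_iff exp_flat_def)
  qed
qed

text \<open>The induction works because \<open>q\<close> is arbitrary. The affine argument covers
  both kinds of factors of the bump, in \<open>w \<bullet> i\<close> and in
  \<open>1 - w \<bullet> i\<close>.\<close>

lemma Ck_on_exp_flat: "Ck_on k UNIV (\<lambda>x. exp_flat q (c * (x \<bullet> a) + d))"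
proof (induction k arbitrary: q)
  case 0
  have "continuous_on UNIV (exp_flat q)"
    by (meson DERIV_continuous_on exp_flat_DERIV has_field_derivative_at_within)
  then show ?case
    by (auto intro!: continuous_on_compose2[where g = "exp_flat q" and t = UNIV] continuous_intros)
next
  case (Suc k)
  let ?q = "pCons 0 (pCons 0 (q - pderiv q))"
  show ?case
  proof (rule Ck_on_SucI)
    show "((\<lambda>x. exp_flat q (c * (x \<bullet> a) + d)) has_derivative
        (\<lambda>v. exp_flat ?q (c * (x \<bullet> a) + d) * (c * (v \<bullet> a)))) (at x)" for x
      by (rule has_derivative_compose[OF _ exp_flat_DERIV[unfolded has_field_derivative_def]])
        (auto intro!: derivative_eq_intros)
    show "Ck_on k UNIV (\<lambda>x. exp_flat ?q (c * (x \<bullet> a) + d) * (c * (v \<bullet> a)))" for v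
      by (intro Ck_on_mult Ck_on_const Suc.IH)
  qed
qed

text \<open>In each coordinate \<open>t\<close> in (0,1) the factor is
  \<open>exp (- 1/t - 1/(1 - t))\<close>. The bump is not normalised; its integral reappears in
  \<open>morrey_const\<close>.\<close>

definition cube_bump :: "'a::euclidean_space \<Rightarrow> real" where
  "cube_bump w = (\<Prod>i\<in>Basis. exp_flat 1 (w \<bullet> i) * exp_flat 1 (1 - w \<bullet> i))"

lemma Ck_on_cube_bump: "Ck_on k UNIV cube_bump"
proof -
  have "Ck_on k UNIV (\<lambda>w. \<Prod>i\<in>Basis. exp_flat 1 (1 * (w \<bullet> i) + 0) * exp_flat 1 (- 1 * (w \<bullet> i) + 1))"
    by (intro Ck_on_prod Ck_on_mult Ck_on_exp_flat)
  then show ?thesis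
    by (simp add: cube_bump_def[abs_def] add.commute)
qed

lemma exp_flat_1_bounds: "0 \<le> exp_flat 1 t" "exp_flat 1 t \<le> 1"
  by (auto simp: exp_flat_def)

lemma cube_bump_nonneg: "0 \<le> cube_bump w"
  unfolding cube_bump_def by (intro prod_nonneg ballI mult_nonneg_nonneg exp_flat_1_bounds)

lemma cube_bump_le_1: "cube_bump w \<le> 1"
  unfolding cube_bump_def
  by (intro prod_le_1 conjI mult_nonneg_nonneg mult_le_one exp_flat_1_bounds)

lemma cube_bump_neq_0_iff: "cube_bump w \<noteq> 0 \<longleftrightarrow> w \<in> box 0 One"
  by (auto simp: cube_bump_def mem_box exp_flat_def)

lemma continuous_on_cube_bump: "continuous_on S cube_bump"
  using Ck_on_cube_bump[of 0] by (auto intro: continuous_on_subset)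

text \<open>A nonnegative continuous function with integral 0 vanishes on the whole cube, but the
  bump is positive at the centre.\<close>

lemma integral_cube_bump_pos: "integral (cbox 0 One) (cube_bump :: 'a::euclidean_space \<Rightarrow> real) > 0"
proof -
  let ?c = "(1/2) *\<^sub>R One :: 'a"
  have int: "(cube_bump :: 'a \<Rightarrow> real) integrable_on cbox 0 One"
    by (intro integrable_continuous continuous_on_cube_bump)
  have "integral (cbox 0 One) (cube_bump :: 'a \<Rightarrow> real) \<noteq> 0"
  proof
    assume "integral (cbox 0 One) (cube_bump :: 'a \<Rightarrow> real) = 0"
    with int have "((cube_bump :: 'a \<Rightarrow> real) has_integral 0) (cbox 0 One)"
      by (simp add: has_integral_iff)
    moreover have "measure lborel (cbox 0 (One :: 'a)) > 0"
      by (simp add: content_cbox_if box_eq_empty)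
    ultimately have "cube_bump ?c = 0"
      by (intro has_integral_0_cbox_imp_0[where a = 0 and b = One])
        (auto simp: cube_bump_nonneg continuous_on_cube_bump mem_box box_ne_empty)
    moreover have "?c \<in> box 0 One"
      by (auto simp: mem_box)
    ultimately show False
      using cube_bump_neq_0_iff by blast
  qed
  moreover have "integral (cbox 0 One) (cube_bump :: 'a \<Rightarrow> real) \<ge> 0"
    by (intro integral_nonneg int cube_bump_nonneg)
  ultimately show ?thesis by linarith
qed

subsection \<open>Morrey's inequality on cubes\<close>

lemma test_functionsI:
  assumes "\<And>k. Ck_on k UNIV \<phi>" and "\<And>x. x \<notin> K \<Longrightarrow> \<phi> x = 0" and "compact K" and "K \<subseteq> \<Omega>"
  shows "\<phi> \<in> test_functions \<Omega>"
proof -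
  have "{x. \<phi> x \<noteq> 0} \<subseteq> K"
    using assms(2) by auto
  then have "closure {x. \<phi> x \<noteq> 0} \<subseteq> K"
    using assms(3) by (meson closure_minimal compact_imp_closed)
  then show ?thesis
    using assms unfolding test_functions_def
    by (auto intro: bounded_subset simp: compact_eq_bounded_closed)
qed

text \<open>Beyond the threshold \<open>T\<close> the second summand is \<open>t\<close> times
  \<open>(t / T) powr (p - 1)\<close>, a factor that is at least 1.\<close>

lemma le_add_powr:
  fixes t T p :: real
  assumes "0 \<le> t" "0 < T" "1 < p"
  shows "t \<le> T + T powr (1 - p) * t powr p"
proof (cases "t \<le> T")
  case False
  then have t: "0 < t" "T < t" using assms by auto
  have "1 \<le> T powr (1 - p) * t powr (p - 1)"
  proof -
    have "T powr (p - 1) \<le> t powr (p - 1)"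
      using t assms by (intro powr_mono2) auto
    moreover have "T powr (1 - p) = 1 / T powr (p - 1)"
      by (metis minus_diff_eq powr_minus_divide)
    ultimately show ?thesis using assms by simp
  qed
  then have "t * 1 \<le> t * (T powr (1 - p) * t powr (p - 1))"
    using t by (intro mult_left_mono) auto
  also have "\<dots> = T powr (1 - p) * t powr p"
    using t by (simp add: powr_mult_base algebra_simps)
  finally show ?thesis using assms by simp
qed (use assms in \<open>auto intro: add_increasing2\<close>)

text \<open>
  Hoelder's inequality up to a factor 2, which comes from using \<open>t \<le> T + T powr (1 - p) * t powr p\<close> with the optimal \<open>T\<close> in
  place of convexity.
\<close>

lemma integral_mult_le_Lp:
  fixes g :: "'a::euclidean_space \<Rightarrow> real"
  assumes p: "1 < p" and g: "integrable (lebesgue_on \<Omega>) (\<lambda>x. \<bar>g x\<bar> powr p)"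
    and \<Omega>: "\<Omega> \<in> sets lebesgue" and S: "S \<in> lmeasurable" "S \<subseteq> \<Omega>"
    and A: "0 < A" "(LINT x:S|lebesgue. \<bar>g x\<bar> powr p) \<le> A"
    and V: "measure lebesgue S = V" "0 < V"
    and \<phi>: "\<And>x. x \<in> S \<Longrightarrow> \<bar>\<phi> x\<bar> \<le> c" "\<And>x. x \<notin> S \<Longrightarrow> \<phi> x = 0" and c: "0 \<le> c"
  shows "\<bar>LINT x|lebesgue_on \<Omega>. g x * \<phi> x\<bar> \<le> 2 * c * A powr (1 / p) * V powr (1 - 1 / p)"
proof (cases "integrable (lebesgue_on \<Omega>) (\<lambda>x. g x * \<phi> x)")
  case True
  \<comment> \<open>The balancing threshold: \<open>T * V\<close> and
    \<open>T powr (1 - p) * A\<close> both become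
    \<open>A powr (1 / p) * V powr (1 - 1 / p)\<close>.\<close>
  define T where "T = (A / V) powr (1 / p)"
  have T: "0 < T" using A V by (simp add: T_def)
  let ?h = "\<lambda>x. c * (T * indicator S x + T powr (1 - p) * (indicator S x * \<bar>g x\<bar> powr p))"
  have gi: "integrable lebesgue (\<lambda>x. indicator \<Omega> x * \<bar>g x\<bar> powr p)"
    using g \<Omega> by (simp add: integrable_restrict_space)
  have Sset: "S \<in> sets lebesgue" using S by blast
  have i1: "integrable lebesgue (\<lambda>x. indicator S x * \<bar>g x\<bar> powr p)"
  proof -
    have "integrable lebesgue (\<lambda>x. indicator S x *\<^sub>R (indicator \<Omega> x * \<bar>g x\<bar> powr p))"
      by (rule integrable_mult_indicator[OF Sset gi])
    moreover have "(\<lambda>x. indicator S x *\<^sub>R (indicator \<Omega> x * \<bar>g x\<bar> powr p)) = (\<lambda>x. indicator S x * \<bar>g x\<bar> powr p)"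
      using S by (intro ext) (auto split: split_indicator)
    ultimately show ?thesis by simp
  qed
  have i2: "integrable lebesgue (indicator S :: 'a \<Rightarrow> real)"
    using S by (auto simp: fmeasurable_def intro!: integrable_real_indicator)
  have h: "integrable lebesgue ?h"
    using i1 i2 by simp
  have "\<bar>LINT x|lebesgue_on \<Omega>. g x * \<phi> x\<bar> = \<bar>LINT x|lebesgue. indicator \<Omega> x * (g x * \<phi> x)\<bar>"
    using \<Omega> by (simp add: integral_restrict_space)
  also have "\<dots> \<le> (LINT x|lebesgue. \<bar>indicator \<Omega> x * (g x * \<phi> x)\<bar>)"
    by (rule integral_abs_bound)
  also have "\<dots> \<le> (LINT x|lebesgue. ?h x)"
  proof (rule integral_mono)
    show "integrable lebesgue (\<lambda>x. \<bar>indicator \<Omega> x * (g x * \<phi> x)\<bar>)"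
      using True \<Omega> by (simp add: integrable_restrict_space)
    show "\<bar>indicator \<Omega> x * (g x * \<phi> x)\<bar> \<le> ?h x" for x
    proof (cases "x \<in> S")
      case True
      have "\<bar>g x\<bar> * \<bar>\<phi> x\<bar> \<le> (T + T powr (1 - p) * \<bar>g x\<bar> powr p) * c"
        using \<phi>(1)[OF True] le_add_powr[OF abs_ge_zero T p, of "g x"] T
        by (intro mult_mono) auto
      then show ?thesis
        using True S by (auto simp: abs_mult algebra_simps)
    qed (simp add: \<phi>(2))
  qed (rule h)
  also have "\<dots> = c * (T * V + T powr (1 - p) * (LINT x:S|lebesgue. \<bar>g x\<bar> powr p))"
    using i1 i2 V by (simp add: set_lebesgue_integral_def Sset)
  also have "\<dots> \<le> c * (T * V + T powr (1 - p) * A)"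
    using A c T by (intro mult_left_mono add_mono) auto
  also have "T * V = A powr (1 / p) * V powr (1 - 1 / p)"
    using A V by (simp add: T_def powr_divide powr_diff)
  also have "T powr (1 - p) * A = A powr (1 / p) * V powr (1 - 1 / p)"
  proof -
    have "T powr (1 - p) = (A / V) powr (1 / p - 1)"
      using p by (simp add: T_def powr_powr field_simps)
    also have "\<dots> = A powr (1 / p) / A * V powr (1 - 1 / p)"
      using A V by (simp add: powr_divide powr_diff)
    finally show ?thesis using A by simp
  qed
  finally show ?thesis by (simp add: algebra_simps)
next
  \<comment> \<open>The Bochner integral is then 0 by convention and the right-hand side is
    nonnegative.\<close>
  case False
  then show ?thesis
    using c by (simp add: not_integrable_integral_eq)
qed

section \<open>Averages of a function against the shrunken bump\<close>

definition cube_bump_partial :: "'a::euclidean_space \<Rightarrow> 'a \<Rightarrow> real" where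
  "cube_bump_partial i w = frechet_derivative cube_bump (at w) i"

lemma cube_bump_has_derivative:
  "(cube_bump has_derivative (\<lambda>v. \<Sum>i\<in>Basis. (v \<bullet> i) * cube_bump_partial i w)) (at w)"
proof -
  have d: "(cube_bump has_derivative frechet_derivative cube_bump (at w)) (at w)"
    using Ck_on_Suc_has_derivative[OF Ck_on_cube_bump] .
  then interpret linear "frechet_derivative cube_bump (at w)"
    by (rule has_derivative_linear)
  have "frechet_derivative cube_bump (at w) v = (\<Sum>i\<in>Basis. (v \<bullet> i) * cube_bump_partial i w)" for v
    by (subst euclidean_representation[of v, symmetric])
      (simp add: sum scaleR cube_bump_partial_def del: euclidean_representation)
  with d show ?thesis by (metis (no_types, lifting) ext)
qed

lemma continuous_on_cube_bump_partial:
  fixes S :: "'a::euclidean_space set"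
  shows "continuous_on S (cube_bump_partial i)"
proof -
  have "Ck_on (Suc 0) UNIV (cube_bump :: 'a \<Rightarrow> real)"
    by (rule Ck_on_cube_bump)
  then have "Ck_on 0 UNIV (cube_bump_partial i)"
    by (simp add: cube_bump_partial_def[abs_def])
  then show ?thesis by (auto intro: continuous_on_subset)
qed

text \<open>The smaller box is the image of the cube under the homothety with centre
  \<open>x\<close> and ratio \<open>s\<close>; its corners are convex combinations of
  \<open>x\<close> and corners of the cube.\<close>

lemma shrunk_cube_subset:
  fixes x :: "'a::euclidean_space"
  assumes x: "x \<in> cbox a b" and s: "0 \<le> s" "s \<le> 1"
  shows "cbox (x + s *\<^sub>R (a - x)) (x + s *\<^sub>R (b - x)) \<subseteq> cbox a b"
proof (rule subset_box_imp)
  show "\<forall>i\<in>Basis. a \<bullet> i \<le> (x + s *\<^sub>R (a - x)) \<bullet> i \<and> (x + s *\<^sub>R (b - x)) \<bullet> i \<le> b \<bullet> i"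
  proof
    fix i :: 'a assume i: "i \<in> Basis"
    have "a \<bullet> i \<le> x \<bullet> i" "x \<bullet> i \<le> b \<bullet> i"
      using x i by (auto simp: mem_box)
    then have "(1 - s) * (a \<bullet> i) \<le> (1 - s) * (x \<bullet> i)" "(1 - s) * (x \<bullet> i) \<le> (1 - s) * (b \<bullet> i)"
      using s by (auto intro!: mult_left_mono)
    then show "a \<bullet> i \<le> (x + s *\<^sub>R (a - x)) \<bullet> i \<and> (x + s *\<^sub>R (b - x)) \<bullet> i \<le> b \<bullet> i"
      by (simp add: inner_simps algebra_simps)
  qed
qed

text \<open>The argument of the bump undoes the homothety and then rescales the cube to the unit
  cube, outside of which the bump is 0.\<close>

lemma cube_bump_shrunk_eq_0:
  fixes x :: "'a::euclidean_space"
  assumes l: "0 < l" and s: "0 < s"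
    and y: "y \<notin> cbox (x + s *\<^sub>R (a - x)) (x + s *\<^sub>R (a + l *\<^sub>R One - x))"
  shows "cube_bump ((x + (1 / s) *\<^sub>R (y - x) - a) /\<^sub>R l) = 0"
proof -
  let ?W = "(x + (1 / s) *\<^sub>R (y - x) - a) /\<^sub>R l"
  have "?W \<notin> box 0 One"
  proof
    assume W: "?W \<in> box 0 One"
    have "(x + s *\<^sub>R (a - x)) \<bullet> i \<le> y \<bullet> i \<and> y \<bullet> i \<le> (x + s *\<^sub>R (a + l *\<^sub>R One - x)) \<bullet> i"
      if "i \<in> Basis" for i
    proof -
      have "0 < (x \<bullet> i + (y \<bullet> i - x \<bullet> i) / s - a \<bullet> i) / l"
        "(x \<bullet> i + (y \<bullet> i - x \<bullet> i) / s - a \<bullet> i) / l < 1"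
        using W that by (auto simp: mem_box inner_simps divide_inverse mult_ac)
      then show ?thesis
        using l s that by (simp add: inner_simps field_simps)
    qed
    then show False using y by (auto simp: mem_box)
  qed
  then show ?thesis
    using cube_bump_neq_0_iff[of ?W] by blast
qed

text \<open>
  After the substitution \<open>y = x + s (w - x)\<close> the average has the kernel
  \<open>K s y = (1/s)\<^sup>n b(x + (y - x)/s)\<close>, and \<open>\<partial>\<^sub>s K\<close> is minus the divergence in \<open>y\<close> of
  \<open>(1/s) K s y (y - x)\<close>; the summands below are the partial derivatives in that divergence.
\<close>

lemma cube_average_has_derivative:
  fixes u :: "'a::euclidean_space \<Rightarrow> real" and a x :: 'a and l s :: real
  defines "Q \<equiv> cbox a (a + l *\<^sub>R One)"
    and "W \<equiv> \<lambda>s y. (x + (1 / s) *\<^sub>R (y - x) - a) /\<^sub>R l"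
  assumes l: "0 < l" and u: "continuous_on Q u" and x: "x \<in> Q" and s: "0 < s" "s < 1"
  shows "((\<lambda>s. integral Q (\<lambda>w. u (x + s *\<^sub>R (w - x)) * cube_bump ((w - a) /\<^sub>R l)))
    has_real_derivative
      - (\<Sum>i\<in>Basis. integral Q (\<lambda>y. u y *
          ((1 / s) ^ (DIM('a) + 1) * (cube_bump (W s y)
            + ((y - x) \<bullet> i) / (s * l) * cube_bump_partial i (W s y)))))) (at s)"
proof -
  define b where "b = a + l *\<^sub>R One"
  have Q: "Q = cbox a b" by (simp add: Q_def b_def)
  define K where "K s y = (1 / s) ^ DIM('a) * cube_bump (W s y)" for s y
  \<comment> \<open>Differentiating \<open>(1 / s) ^ DIM('a)\<close> produces \<open>DIM('a)\<close>
    copies of the bump; they are distributed over the sum, one for each coordinate.\<close>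
  define dK where "dK s y = - ((1 / s) ^ (DIM('a) + 1) * (\<Sum>i\<in>Basis. cube_bump (W s y)
            + ((y - x) \<bullet> i) / (s * l) * cube_bump_partial i (W s y)))" for s y
  have contW: "continuous_on ({0<..<1} \<times> cbox a b) (\<lambda>z. W (fst z) (snd z))"
    unfolding W_def using l by (intro continuous_intros) auto
  have contu: "continuous_on ({0<..<1} \<times> cbox a b) (\<lambda>z. u (snd z))"
    by (rule continuous_on_compose2[OF u[unfolded Q]]) (auto intro!: continuous_intros)
  have contB: "continuous_on ({0<..<1} \<times> cbox a b) (\<lambda>z. cube_bump (W (fst z) (snd z)))"
    by (rule continuous_on_compose2[OF continuous_on_cube_bump[of UNIV] contW]) auto
  have contdB: "continuous_on ({0<..<1} \<times> cbox a b) (\<lambda>z. cube_bump_partial i (W (fst z) (snd z)))" for i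
    by (rule continuous_on_compose2[OF continuous_on_cube_bump_partial[of UNIV] contW]) auto
  have slice: "continuous_on (cbox a b) (\<lambda>y. h (s, y))"
    if "continuous_on ({0<..<1} \<times> cbox a b) h" "s \<in> {0<..<1}" for h :: "real \<times> 'a \<Rightarrow> real" and s
    by (rule continuous_on_compose2[OF that(1)]) (use that in \<open>auto intro!: continuous_intros\<close>)
  have contK: "continuous_on ({0<..<1} \<times> cbox a b) (\<lambda>z. u (snd z) * K (fst z) (snd z))"
    unfolding K_def by (intro continuous_intros contu contB) auto
  have contdK: "continuous_on ({0<..<1} \<times> cbox a b) (\<lambda>z. u (snd z) * dK (fst z) (snd z))"
    unfolding dK_def using l by (intro continuous_intros contu contB contdB) auto
  have dK: "((\<lambda>s. K s y) has_real_derivative dK s y) (at s)" if "s \<in> {0<..<1}" for s y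
  proof -
    have "((\<lambda>s. W s y) has_derivative (\<lambda>h. h *\<^sub>R (- (1 / s\<^sup>2) *\<^sub>R (y - x) /\<^sub>R l))) (at s)"
      unfolding W_def using that l
      by (auto intro!: derivative_eq_intros simp: power2_eq_square field_simps)
    from has_derivative_compose[OF this cube_bump_has_derivative]
    have "((\<lambda>s. cube_bump (W s y)) has_derivative (\<lambda>h. \<Sum>i\<in>Basis.
        (h *\<^sub>R (- (1 / s\<^sup>2) *\<^sub>R (y - x) /\<^sub>R l)) \<bullet> i * cube_bump_partial i (W s y))) (at s)" .
    moreover have "(\<lambda>h. \<Sum>i\<in>Basis. (h *\<^sub>R (- (1 / s\<^sup>2) *\<^sub>R (y - x) /\<^sub>R l)) \<bullet> i * cube_bump_partial i (W s y))
      = (*) (- (1 / s) * (\<Sum>i\<in>Basis. ((y - x) \<bullet> i) / (s * l) * cube_bump_partial i (W s y)))"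
      by (auto simp: sum_distrib_left sum_distrib_right power2_eq_square fun_eq_iff divide_inverse sum_negf
          mult_ac simp flip: sum_negf)
    ultimately have dB: "((\<lambda>s. cube_bump (W s y)) has_real_derivative
        (- (1 / s) * (\<Sum>i\<in>Basis. ((y - x) \<bullet> i) / (s * l) * cube_bump_partial i (W s y)))) (at s)"
      by (simp add: has_field_derivative_def)
    have dp: "((\<lambda>s. (1 / s) ^ DIM('a)) has_real_derivative - (real DIM('a) * (1 / s) ^ (DIM('a) + 1))) (at s)"
    proof -
      have d1: "((\<lambda>s. 1 / s) has_real_derivative - (1 / s\<^sup>2)) (at s)"
        using that by (auto intro!: derivative_eq_intros simp: power2_eq_square)
      obtain m where m: "DIM('a) = Suc m"
        using DIM_positive[where 'a = 'a] gr0_implies_Suc by blast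
      show ?thesis
        using DERIV_power[OF d1, of "Suc m"] that
        by (simp add: m power2_eq_square mult_ac)
    qed
    show ?thesis
      unfolding K_def
      by (rule derivative_eq_intros dp dB refl)+
        (simp add: dK_def sum.distrib algebra_simps)
  qed
  \<comment> \<open>In this form \<open>s\<close> occurs only in the smooth kernel, so
    differentiation under the integral asks no more of \<open>u\<close> than continuity.\<close>
  have leib: "((\<lambda>s. integral (cbox a b) (\<lambda>y. u y * K s y)) has_real_derivative
      integral (cbox a b) (\<lambda>y. u y * dK s y)) (at s within {0<..<1})"
  proof (rule leibniz_rule_field_derivative)
    show "((\<lambda>s. u y * K s y) has_real_derivative u y * dK s y) (at s within {0<..<1})"
      if "s \<in> {0<..<1}" for s y
      using DERIV_cmult[OF dK[OF that]] has_field_derivative_at_within by blast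
    show "(\<lambda>y. u y * K s y) integrable_on cbox a b" if "s \<in> {0<..<1}" for s
      using slice[OF contK that] by (intro integrable_continuous) simp
    show "continuous_on ({0<..<1} \<times> cbox a b) (\<lambda>(s, y). u y * dK s y)"
      using contdK by (simp add: case_prod_unfold)
  qed (use s in auto)
  have "((\<lambda>s. integral (cbox a b) (\<lambda>y. u y * K s y)) has_real_derivative
      integral (cbox a b) (\<lambda>y. u y * dK s y)) (at s)"
    using leib s at_within_open[of s "{0<..<1}"] by simp
  moreover have "integral (cbox a b) (\<lambda>y. u y * dK s y) =
      - (\<Sum>i\<in>Basis. integral Q (\<lambda>y. u y *
          ((1 / s) ^ (DIM('a) + 1) * (cube_bump (W s y)
            + ((y - x) \<bullet> i) / (s * l) * cube_bump_partial i (W s y)))))"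
  proof -
    have "(\<lambda>y. u y * ((1 / s) ^ (DIM('a) + 1) * (cube_bump (W s y)
            + ((y - x) \<bullet> i) / (s * l) * cube_bump_partial i (W s y)))) integrable_on Q" for i
    proof -
      have "continuous_on ({0<..<1} \<times> cbox a b) (\<lambda>z. u (snd z) * ((1 / fst z) ^ (DIM('a) + 1) * (cube_bump (W (fst z) (snd z))
            + ((snd z - x) \<bullet> i) / (fst z * l) * cube_bump_partial i (W (fst z) (snd z)))))"
        using l by (intro continuous_intros contu contB contdB) auto
      from slice[OF this, of s] s show ?thesis
        unfolding Q by (intro integrable_continuous) simp
    qed
    then have "(\<Sum>i\<in>Basis. integral Q (\<lambda>y. u y *
          ((1 / s) ^ (DIM('a) + 1) * (cube_bump (W s y)
            + ((y - x) \<bullet> i) / (s * l) * cube_bump_partial i (W s y)))))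
      = integral Q (\<lambda>y. \<Sum>i\<in>Basis. u y *
          ((1 / s) ^ (DIM('a) + 1) * (cube_bump (W s y)
            + ((y - x) \<bullet> i) / (s * l) * cube_bump_partial i (W s y))))"
      by (intro integral_sum[symmetric]) auto
    also have "\<dots> = integral Q (\<lambda>y. - (u y * dK s y))"
      by (rule arg_cong[where f = "integral Q"]) (simp add: dK_def sum_distrib_left fun_eq_iff)
    finally show ?thesis
      unfolding Q by simp
  qed
  ultimately have main: "((\<lambda>s. integral (cbox a b) (\<lambda>y. u y * K s y)) has_real_derivative
      - (\<Sum>i\<in>Basis. integral Q (\<lambda>y. u y *
          ((1 / s) ^ (DIM('a) + 1) * (cube_bump (W s y)
            + ((y - x) \<bullet> i) / (s * l) * cube_bump_partial i (W s y)))))) (at s)"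
    by simp
  \<comment> \<open>The kernel vanishes off the shrunken box, so the integral may be restricted to
    it. The homothety maps the cube onto this box, and its Jacobian cancels
    \<open>(1 / s) ^ DIM('a)\<close>.\<close>
  have eq: "integral (cbox a b) (\<lambda>y. u y * K s y) =
      integral Q (\<lambda>w. u (x + s *\<^sub>R (w - x)) * cube_bump ((w - a) /\<^sub>R l))"
    if s: "s \<in> {0<..<1}" for s
  proof -
    define a' where "a' = x + s *\<^sub>R (a - x)"
    define b' where "b' = x + s *\<^sub>R (b - x)"
    have sub: "cbox a' b' \<subseteq> cbox a b"
      unfolding a'_def b'_def by (rule shrunk_cube_subset) (use x s Q in auto)
    have zero: "u y * K s y = 0" if "y \<notin> cbox a' b'" for y
      using cube_bump_shrunk_eq_0[OF l, of s y x a] that s by (simp add: K_def W_def a'_def b'_def b_def)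
    have "(\<lambda>y. u y * K s y) integrable_on cbox a b"
      using slice[OF contK s] by (intro integrable_continuous) simp
    then have int': "(\<lambda>y. u y * K s y) integrable_on cbox a' b'"
      using sub integrable_on_subcbox by blast
    have e1: "integral (cbox a b) (\<lambda>y. u y * K s y) = integral (cbox a' b') (\<lambda>y. u y * K s y)"
      using has_integral_on_superset[OF integrable_integral[OF int'] zero sub]
      by (simp add: integral_unique)
    have "((\<lambda>w. u (s *\<^sub>R w + (x - s *\<^sub>R x)) * K s (s *\<^sub>R w + (x - s *\<^sub>R x))) has_integral
        (integral (cbox a' b') (\<lambda>y. u y * K s y) /\<^sub>R s ^ DIM('a)))
      (cbox ((a' - (x - s *\<^sub>R x)) /\<^sub>R s) ((b' - (x - s *\<^sub>R x)) /\<^sub>R s))"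
      by (rule has_integral_affinity'[OF integrable_integral[OF int']]) (use s in auto)
    moreover have "(a' - (x - s *\<^sub>R x)) /\<^sub>R s = a" "(b' - (x - s *\<^sub>R x)) /\<^sub>R s = b"
      using s by (auto simp: a'_def b'_def algebra_simps)
    moreover have "W s (x + s *\<^sub>R (w - x)) = (w - a) /\<^sub>R l" for w
      using s by (simp add: W_def algebra_simps)
    moreover have "s *\<^sub>R w + (x - s *\<^sub>R x) = x + s *\<^sub>R (w - x)" for w
      by (simp add: algebra_simps)
    ultimately have "((\<lambda>w. u (x + s *\<^sub>R (w - x)) * ((1 / s) ^ DIM('a) * cube_bump ((w - a) /\<^sub>R l)))
        has_integral (integral (cbox a' b') (\<lambda>y. u y * K s y) /\<^sub>R s ^ DIM('a))) (cbox a b)"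
      by (simp only: K_def)
    from has_integral_mult_right[OF this, of "s ^ DIM('a)"]
    have "((\<lambda>w. u (x + s *\<^sub>R (w - x)) * cube_bump ((w - a) /\<^sub>R l))
        has_integral (integral (cbox a' b') (\<lambda>y. u y * K s y))) (cbox a b)"
      using s by (simp add: field_simps power_one_over)
    then show ?thesis
      unfolding e1 Q by (simp add: integral_unique)
  qed
  show ?thesis
    by (rule has_field_derivative_transform_within_open[OF main, of "{0<..<1}"]) (use s eq in auto)
qed

text \<open>The functions \<open>\<phi> i\<close> are the components of the field
  \<open>(1/s) K s y (y - x)\<close> in the divergence formula above. They are supported in
  \<open>Q\<close>, hence admissible in the definition of weak derivatives, and their partial
  derivatives are exactly the summands found there.\<close>

lemma cube_kernel_test_function:
  fixes a x :: "'a::euclidean_space" and l s :: real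
  defines "Q \<equiv> cbox a (a + l *\<^sub>R One)"
    and "W \<equiv> \<lambda>y. (x + (1 / s) *\<^sub>R (y - x) - a) /\<^sub>R l"
  defines "\<phi> \<equiv> \<lambda>i y. (1 / s) ^ (DIM('a) + 1) * (((y - x) \<bullet> i) * cube_bump (W y))"
  assumes l: "0 < l" and x: "x \<in> Q" and s: "0 < s" "s < 1" and Q: "Q \<subseteq> \<Omega>" and i: "i \<in> Basis"
  shows "\<phi> i \<in> test_functions \<Omega>"
    and "frechet_derivative (\<phi> i) (at y) i = (1 / s) ^ (DIM('a) + 1) * (cube_bump (W y)
            + ((y - x) \<bullet> i) / (s * l) * cube_bump_partial i (W y))"
    and "y \<notin> Q \<Longrightarrow> frechet_derivative (\<phi> i) (at y) i = 0"
proof -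
  have zero: "\<phi> i y = 0" if "y \<notin> Q" for y
  proof -
    have "y \<notin> cbox (x + s *\<^sub>R (a - x)) (x + s *\<^sub>R (a + l *\<^sub>R One - x))"
      using that shrunk_cube_subset[of x a "a + l *\<^sub>R One" s] x s by (auto simp: Q_def)
    from cube_bump_shrunk_eq_0[OF l s(1) this] show ?thesis
      by (simp add: \<phi>_def W_def)
  qed
  have W: "W y = (1 / (s * l)) *\<^sub>R y + (x - (1 / s) *\<^sub>R x - a) /\<^sub>R l" for y
    using l s by (simp add: W_def algebra_simps inverse_eq_divide)
  show "\<phi> i \<in> test_functions \<Omega>"
  proof (rule test_functionsI[OF _ zero _ Q])
    show "Ck_on k UNIV (\<phi> i)" for k
    proof -
      have "Ck_on k UNIV (\<lambda>y. (1 / s) ^ (DIM('a) + 1) * ((y \<bullet> i + - (x \<bullet> i))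
          * cube_bump ((1 / (s * l)) *\<^sub>R y + (x - (1 / s) *\<^sub>R x - a) /\<^sub>R l)))"
        by (intro Ck_on_mult Ck_on_const Ck_on_add Ck_on_inner Ck_on_affine Ck_on_cube_bump)
      then show ?thesis
        by (simp add: \<phi>_def W inner_simps)
    qed
  qed (auto simp: Q_def)
  have dW: "(W has_derivative (\<lambda>v. (1 / (s * l)) *\<^sub>R v)) (at y)"
    unfolding W[abs_def] by (auto intro!: derivative_eq_intros)
  have "((\<lambda>y. cube_bump (W y)) has_derivative
      (\<lambda>v. \<Sum>j\<in>Basis. ((1 / (s * l)) *\<^sub>R v) \<bullet> j * cube_bump_partial j (W y))) (at y)"
    by (rule has_derivative_compose[OF dW cube_bump_has_derivative])
  then have "(\<phi> i has_derivative (\<lambda>v. (1 / s) ^ (DIM('a) + 1) * (((y - x) \<bullet> i) *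
      (\<Sum>j\<in>Basis. ((1 / (s * l)) *\<^sub>R v) \<bullet> j * cube_bump_partial j (W y)) + (v \<bullet> i) * cube_bump (W y)))) (at y)"
    unfolding \<phi>_def
    by (intro has_derivative_mult_right has_derivative_mult) (auto intro!: derivative_eq_intros)
  note eq = frechet_derivative_at[OF this, symmetric]
  have "frechet_derivative (\<phi> i) (at y) i = (1 / s) ^ (DIM('a) + 1) * (((y - x) \<bullet> i) *
      (\<Sum>j\<in>Basis. ((1 / (s * l)) *\<^sub>R i) \<bullet> j * cube_bump_partial j (W y)) + (i \<bullet> i) * cube_bump (W y))"
    by (simp only: eq)
  also have "(\<Sum>j\<in>Basis. ((1 / (s * l)) *\<^sub>R i) \<bullet> j * cube_bump_partial j (W y))
      = (\<Sum>j\<in>Basis. if i = j then (1 / (s * l)) * cube_bump_partial j (W y) else 0)"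
    using i by (intro sum.cong) (auto simp: inner_Basis)
  also have "\<dots> = 1 / (s * l) * cube_bump_partial i (W y)"
    using i by simp
  finally show "frechet_derivative (\<phi> i) (at y) i = (1 / s) ^ (DIM('a) + 1) * (cube_bump (W y)
            + ((y - x) \<bullet> i) / (s * l) * cube_bump_partial i (W y))"
    using i by (simp add: algebra_simps)
  show "frechet_derivative (\<phi> i) (at y) i = 0" if "y \<notin> Q"
  proof -
    have "(\<phi> i has_derivative (\<lambda>v. 0)) (at y)"
      by (rule has_derivative_transform_within_open[OF has_derivative_const, where s = "- Q"])
        (use that zero in \<open>auto simp: Q_def open_Compl\<close>)
    from frechet_derivative_at[OF this, symmetric] show ?thesis by simp
  qed
qed

text \<open>Links the Lebesgue integrals over the domain in \<open>weak_derivative\<close> with the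
  gauge integrals over the cube used for the averages.\<close>

lemma integral_lebesgue_on_eq_cbox:
  fixes h :: "'a::euclidean_space \<Rightarrow> real"
  assumes \<Omega>: "\<Omega> \<in> sets lebesgue" "cbox a b \<subseteq> \<Omega>" and h: "continuous_on (cbox a b) h"
    and zero: "\<And>y. y \<notin> cbox a b \<Longrightarrow> h y = 0"
  shows "(LINT y|lebesgue_on \<Omega>. h y) = integral (cbox a b) h"
proof -
  have "(LINT y|lebesgue_on \<Omega>. h y) = (LINT y|lebesgue. indicator \<Omega> y * h y)"
    using \<Omega> by (simp add: integral_restrict_space)
  also have "\<dots> = (LINT y|lebesgue. indicator (cbox a b) y * h y)"
    using \<Omega>(2) zero by (intro Bochner_Integration.integral_cong) (auto split: split_indicator)
  also have "\<dots> = (LINT y|lebesgue_on (cbox a b). h y)"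
    by (simp add: integral_restrict_space)
  also have "\<dots> = integral (cbox a b) h"
    by (intro lebesgue_integral_eq_integral continuous_imp_integrable h) auto
  finally show ?thesis .
qed

text \<open>The weak derivative replaces \<open>u\<close> times the derivative of a test function by
  \<open>g i\<close> times the test function, and the Hoelder estimate is applied on the shrunken
  cube. The singularity in \<open>s\<close> that results is integrable at 0 precisely when
  \<open>p\<close> exceeds the dimension.\<close>

lemma cube_average_derivative_bound:
  fixes u :: "'a::euclidean_space \<Rightarrow> real" and a x :: 'a and l s p A :: real
  defines "Q \<equiv> cbox a (a + l *\<^sub>R One)"
  assumes l: "0 < l" and u: "continuous_on Q u" and x: "x \<in> Q" and s: "0 < s" "s < 1"
    and \<Omega>: "open \<Omega>" "Q \<subseteq> \<Omega>" and p: "1 < p"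
    and g: "\<And>i. i \<in> Basis \<Longrightarrow> g i \<in> Lp_on p \<Omega>" "\<And>i. i \<in> Basis \<Longrightarrow> weak_derivative \<Omega> i u (g i)"
    and A: "0 < A" "\<And>i. i \<in> Basis \<Longrightarrow> (LINT y:Q|lebesgue. \<bar>g i y\<bar> powr p) \<le> A"
  shows "\<exists>D. ((\<lambda>s. integral Q (\<lambda>w. u (x + s *\<^sub>R (w - x)) * cube_bump ((w - a) /\<^sub>R l)))
      has_real_derivative D) (at s) \<and>
    \<bar>D\<bar> \<le> 2 * real DIM('a) * l powr (1 + real DIM('a) - real DIM('a) / p) * A powr (1 / p) * s powr - (real DIM('a) / p)"
proof -
  let ?n = "real DIM('a)"
  define W where "W y = (x + (1 / s) *\<^sub>R (y - x) - a) /\<^sub>R l" for y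
  define \<phi> where "\<phi> i y = (1 / s) ^ (DIM('a) + 1) * (((y - x) \<bullet> i) * cube_bump (W y))" for i y
  define h where "h i y = u y * ((1 / s) ^ (DIM('a) + 1) * (cube_bump (W y)
            + ((y - x) \<bullet> i) / (s * l) * cube_bump_partial i (W y)))" for i y
  define D where "D = - (\<Sum>i\<in>Basis. integral Q (h i))"
  note test = cube_kernel_test_function[OF l x[unfolded Q_def] s \<Omega>(2)[unfolded Q_def],
      folded Q_def W_def \<phi>_def]
  have deriv: "((\<lambda>s. integral Q (\<lambda>w. u (x + s *\<^sub>R (w - x)) * cube_bump ((w - a) /\<^sub>R l)))
      has_real_derivative D) (at s)"
    using cube_average_has_derivative[OF l u[unfolded Q_def] x[unfolded Q_def] s]
    unfolding D_def h_def W_def Q_def .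
  \<comment> \<open>The test functions live on this box of side \<open>s * l\<close>; its small
    volume, instead of that of \<open>Q\<close>, gives the right power of \<open>s\<close>.\<close>
  define S where "S = cbox (x + s *\<^sub>R (a - x)) (x + s *\<^sub>R (a + l *\<^sub>R One - x))"
  have S: "S \<subseteq> Q"
    using shrunk_cube_subset[of x a "a + l *\<^sub>R One" s] x s by (simp add: S_def Q_def)
  have V: "measure lebesgue S = (s * l) ^ DIM('a)"
  proof -
    have "measure lebesgue S = (\<Prod>i\<in>Basis. (x + s *\<^sub>R (a + l *\<^sub>R One - x) - (x + s *\<^sub>R (a - x))) \<bullet> (i::'a))"
      unfolding S_def using l s by (subst measure_completion, simp, subst measure_lborel_cbox_eq)
        (auto simp: inner_simps algebra_simps)
    also have "\<dots> = (\<Prod>i\<in>(Basis::'a set). s * l)"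
      by (intro prod.cong) (auto simp: inner_simps algebra_simps)
    finally show ?thesis by simp
  qed
  \<comment> \<open>A bound for the test functions on \<open>S\<close>: both \<open>x\<close> and
    \<open>y\<close> lie in this box, so the coordinates of \<open>y - x\<close> are at most
    \<open>s * l\<close>, and the bump is at most 1.\<close>
  define c where "c = (1 / s) ^ (DIM('a) + 1) * (s * l)"
  have bound: "\<bar>integral Q (h i)\<bar> \<le> 2 * c * A powr (1 / p) * ((s * l) ^ DIM('a)) powr (1 - 1 / p)"
    if i: "i \<in> Basis" for i
  proof -
    have hi: "h i y = u y * frechet_derivative (\<phi> i) (at y) i" for y
      using test(2)[OF i] by (simp add: h_def)
    have "continuous_on Q (h i)"
      unfolding h_def W_def using l s
      by (intro continuous_intros u continuous_on_compose2[OF continuous_on_cube_bump[of UNIV]]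
          continuous_on_compose2[OF continuous_on_cube_bump_partial[of UNIV]]) auto
    then have "(LINT y|lebesgue_on \<Omega>. h i y) = integral Q (h i)"
      unfolding Q_def
      by (rule integral_lebesgue_on_eq_cbox[rotated 2])
        (use test(3)[OF i] \<Omega> hi in \<open>auto simp: Q_def\<close>)
    then have "\<bar>integral Q (h i)\<bar> = \<bar>LINT y|lebesgue_on \<Omega>. g i y * \<phi> i y\<bar>"
      using g(2)[OF i] test(1)[OF i] by (simp add: weak_derivative_def hi)
    also have "\<dots> \<le> 2 * c * A powr (1 / p) * ((s * l) ^ DIM('a)) powr (1 - 1 / p)"
    proof (rule integral_mult_le_Lp[where S = S])
      show "integrable (lebesgue_on \<Omega>) (\<lambda>x. \<bar>g i x\<bar> powr p)"
        using g(1)[OF i] by (simp add: Lp_on_def)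
      have gi: "integrable lebesgue (\<lambda>x. indicator \<Omega> x *\<^sub>R \<bar>g i x\<bar> powr p)"
        using g(1)[OF i] \<Omega> by (simp add: Lp_on_def integrable_restrict_space)
      have "(LINT y:S|lebesgue. \<bar>g i y\<bar> powr p) \<le> (LINT y:Q|lebesgue. \<bar>g i y\<bar> powr p)"
      proof -
        have "set_integrable lebesgue Q (\<lambda>y. \<bar>g i y\<bar> powr p)"
          by (rule set_integrable_subset[of _ \<Omega>])
            (use gi \<Omega>(2) in \<open>auto simp: set_integrable_def Q_def\<close>)
        moreover from this have "set_integrable lebesgue S (\<lambda>y. \<bar>g i y\<bar> powr p)"
          by (rule set_integrable_subset) (use S in \<open>auto simp: S_def\<close>)
        ultimately show ?thesis
          unfolding set_lebesgue_integral_def set_integrable_def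
          by (intro integral_mono) (use S in \<open>auto split: split_indicator\<close>)
      qed
      then show "(LINT y:S|lebesgue. \<bar>g i y\<bar> powr p) \<le> A"
        using A(2)[OF i] by linarith
      show "\<bar>\<phi> i y\<bar> \<le> c" if "y \<in> S" for y
      proof -
        have "x \<bullet> i + s * (a \<bullet> i - x \<bullet> i) \<le> y \<bullet> i" "y \<bullet> i \<le> x \<bullet> i + s * (a \<bullet> i + l - x \<bullet> i)"
          using that i by (auto simp: S_def mem_box inner_simps)
        moreover have "0 \<le> s * (x \<bullet> i - a \<bullet> i)" "s * (x \<bullet> i - a \<bullet> i) \<le> s * l"
          using x i s by (auto simp: Q_def mem_box inner_simps intro!: mult_nonneg_nonneg mult_left_mono)
        ultimately have "\<bar>(y - x) \<bullet> i\<bar> \<le> s * l"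
          by (auto simp: inner_simps algebra_simps abs_le_iff)
        then have "\<bar>(y - x) \<bullet> i\<bar> * cube_bump (W y) \<le> (s * l) * 1"
          using l s by (intro mult_mono cube_bump_le_1 cube_bump_nonneg) auto
        then have "(1 / s) ^ (DIM('a) + 1) * (\<bar>(y - x) \<bullet> i\<bar> * cube_bump (W y)) \<le> c"
          unfolding c_def using s by (intro mult_left_mono) auto
        moreover have "\<bar>\<phi> i y\<bar> = (1 / s) ^ (DIM('a) + 1) * (\<bar>(y - x) \<bullet> i\<bar> * cube_bump (W y))"
          using s cube_bump_nonneg[of "W y"] by (simp add: \<phi>_def abs_mult)
        ultimately show ?thesis by simp
      qed
      show "\<phi> i y = 0" if "y \<notin> S" for y
        using cube_bump_shrunk_eq_0[OF l s(1), of y x a] that by (simp add: \<phi>_def W_def S_def)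
    qed (use p \<Omega> S A(1) V l s in \<open>auto simp: S_def c_def\<close>)
    finally show ?thesis .
  qed
  have "\<bar>D\<bar> \<le> (\<Sum>i\<in>(Basis::'a set). \<bar>integral Q (h i)\<bar>)"
    by (simp add: D_def)
  also have "\<dots> \<le> (\<Sum>i\<in>(Basis::'a set). 2 * c * A powr (1 / p) * ((s * l) ^ DIM('a)) powr (1 - 1 / p))"
    by (intro sum_mono bound)
  also have "\<dots> = 2 * ?n * A powr (1 / p) * (c * ((s * l) ^ DIM('a)) powr (1 - 1 / p))"
    by simp
  also have "c * ((s * l) ^ DIM('a)) powr (1 - 1 / p) = l powr (1 + ?n - ?n / p) * s powr - (?n / p)"
  proof -
    have "c = s powr (- ?n) * l"
      using s by (simp add: c_def powr_minus powr_realpow field_simps)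
    moreover have "((s * l) ^ DIM('a)) powr (1 - 1 / p) = s powr (?n - ?n / p) * l powr (?n - ?n / p)"
      using s l by (simp add: powr_realpow[symmetric] powr_powr powr_mult algebra_simps)
    ultimately have "c * ((s * l) ^ DIM('a)) powr (1 - 1 / p) =
        (s powr (- ?n) * s powr (?n - ?n / p)) * (l powr 1 * l powr (?n - ?n / p))"
      using l by simp
    also have "\<dots> = s powr - (?n / p) * l powr (1 + ?n - ?n / p)"
      by (simp only: powr_add[symmetric]) (simp add: algebra_simps)
    finally show ?thesis by (simp only: mult.commute)
  qed
  finally have "\<bar>D\<bar> \<le> 2 * ?n * l powr (1 + ?n - ?n / p) * A powr (1 / p) * s powr - (?n / p)"
    by (simp add: mult_ac)
  with deriv show ?thesis by (intro exI conjI)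
qed

text \<open>The primitive \<open>B / (1 - q) * s powr (1 - q)\<close> of the bound minus
  \<open>F\<close>, or plus \<open>F\<close>, is nondecreasing; the sign \<open>\<sigma>\<close>
  treats both. Continuity at the endpoints lets the derivative bound blow up at 0.\<close>

lemma powr_derivative_bound_imp_diff_bound:
  fixes F :: "real \<Rightarrow> real"
  assumes cont: "continuous_on {0..1} F" and q: "q < 1"
    and D: "\<And>s. 0 < s \<Longrightarrow> s < 1 \<Longrightarrow> \<exists>D. (F has_real_derivative D) (at s) \<and> \<bar>D\<bar> \<le> B * s powr (- q)"
  shows "\<bar>F 1 - F 0\<bar> \<le> B / (1 - q)"
proof -
  have "\<sigma> * (F 1 - F 0) \<le> B / (1 - q)" if \<sigma>: "\<bar>\<sigma>\<bar> = 1" for \<sigma> :: real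
  proof -
    let ?H = "\<lambda>s. B / (1 - q) * s powr (1 - q) - \<sigma> * F s"
    have "?H 0 \<le> ?H 1"
    proof (rule DERIV_nonneg_imp_increasing_open[where f = ?H and a = 0 and b = 1])
      fix s :: real assume s: "0 < s" "s < 1"
      then obtain D where D: "(F has_real_derivative D) (at s)" "\<bar>D\<bar> \<le> B * s powr (- q)"
        using assms(3) by blast
      have "(?H has_real_derivative B * s powr (- q) - \<sigma> * D) (at s)"
        using DERIV_diff[OF DERIV_cmult[OF has_real_derivative_powr[OF s(1), of "1 - q"],
              of "B / (1 - q)"] DERIV_cmult[OF D(1), of \<sigma>]] q by simp
      moreover have "\<sigma> * D \<le> \<bar>D\<bar>"
        using \<sigma> abs_mult[of \<sigma> D] by (metis abs_ge_self mult_1)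
      ultimately show "\<exists>y. (?H has_real_derivative y) (at s) \<and> 0 \<le> y"
        using D(2) by (intro exI[of _ "B * s powr (- q) - \<sigma> * D"]) auto
    next
      show "continuous_on {0..1} ?H"
        using q by (intro continuous_on_diff continuous_on_mult continuous_on_powr' cont
            continuous_on_const continuous_on_id) auto
    qed simp
    then show ?thesis using q by (simp add: algebra_simps)
  qed
  from this[of 1] this[of "-1"] show ?thesis by simp
qed

text \<open>The 4 is the 2 of the Hoelder estimate times a 2 for comparing two points with the
  average. The divisor \<open>1 - real DIM('a) / p\<close> comes from integrating the singularity in
  \<open>s\<close>, the last one from the missing normalisation of the bump.\<close>

definition morrey_const :: "'a::euclidean_space itself \<Rightarrow> real \<Rightarrow> real" where
  "morrey_const _ p = 4 * real DIM('a) / (1 - real DIM('a) / p) / integral (cbox 0 One) (cube_bump :: 'a \<Rightarrow> real)"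

lemma integral_scaled_cube_bump:
  fixes a :: "'a::euclidean_space"
  assumes "0 < l"
  shows "integral (cbox a (a + l *\<^sub>R One)) (\<lambda>w. cube_bump ((w - a) /\<^sub>R l)) =
    l ^ DIM('a) * integral (cbox 0 One) (cube_bump :: 'a \<Rightarrow> real)"
proof -
  have "((cube_bump :: 'a \<Rightarrow> real) has_integral integral (cbox 0 One) (cube_bump :: 'a \<Rightarrow> real)) (cbox 0 One)"
    by (intro integrable_integral integrable_continuous continuous_on_cube_bump)
  from has_integral_affinity'[OF this, of "1 / l" "- (a /\<^sub>R l)"] assms
  have "((\<lambda>w. cube_bump ((1 / l) *\<^sub>R w + - (a /\<^sub>R l))) has_integral
      integral (cbox 0 One) (cube_bump :: 'a \<Rightarrow> real) /\<^sub>R (1 / l) ^ DIM('a))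
    (cbox ((0 - - (a /\<^sub>R l)) /\<^sub>R (1 / l)) ((One - - (a /\<^sub>R l)) /\<^sub>R (1 / l)))"
    by simp
  moreover have "(1 / l) *\<^sub>R w + - (a /\<^sub>R l) = (w - a) /\<^sub>R l" for w
    by (simp add: algebra_simps inverse_eq_divide)
  moreover have "(0 - - (a /\<^sub>R l)) /\<^sub>R (1 / l) = a" "(One - - (a /\<^sub>R l)) /\<^sub>R (1 / l) = a + l *\<^sub>R One"
    using assms by (auto simp: algebra_simps)
  ultimately show ?thesis
    by (simp add: integral_unique power_one_over mult.commute)
qed

text \<open>Both \<open>u x\<close> and \<open>u y\<close>, times the mass of the scaled bump, are
  compared with one and the same weighted integral over the cube.\<close>

lemma morrey_cube:
  fixes u :: "'a::euclidean_space \<Rightarrow> real" and a :: 'a and l p A :: real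
  defines "Q \<equiv> cbox a (a + l *\<^sub>R One)"
  assumes l: "0 < l" and u: "continuous_on Q u" and x: "x \<in> Q" and y: "y \<in> Q"
    and \<Omega>: "open \<Omega>" "Q \<subseteq> \<Omega>" and p: "real DIM('a) < p"
    and g: "\<And>i. i \<in> Basis \<Longrightarrow> g i \<in> Lp_on p \<Omega>" "\<And>i. i \<in> Basis \<Longrightarrow> weak_derivative \<Omega> i u (g i)"
    and A: "0 < A" "\<And>i. i \<in> Basis \<Longrightarrow> (LINT y:Q|lebesgue. \<bar>g i y\<bar> powr p) \<le> A"
  shows "\<bar>u x - u y\<bar> \<le> morrey_const TYPE('a) p * l powr (1 - real DIM('a) / p) * A powr (1 / p)"
proof -
  let ?n = "real DIM('a)"
  define I0 where "I0 = integral (cbox 0 One) (cube_bump :: 'a \<Rightarrow> real)"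
  have I0: "0 < I0" unfolding I0_def by (rule integral_cube_bump_pos)
  define B where "B = 2 * ?n * l powr (1 + ?n - ?n / p) * A powr (1 / p)"
  have n: "1 \<le> ?n" by (simp add: Suc_leI)
  have q: "?n / p < 1" using p n by simp
  have avg: "\<bar>integral Q (\<lambda>w. u w * cube_bump ((w - a) /\<^sub>R l)) - u x * (l ^ DIM('a) * I0)\<bar> \<le> B / (1 - ?n / p)"
    if x: "x \<in> Q" for x
  proof -
    let ?F = "\<lambda>s. integral Q (\<lambda>w. u (x + s *\<^sub>R (w - x)) * cube_bump ((w - a) /\<^sub>R l))"
    have "\<bar>?F 1 - ?F 0\<bar> \<le> B / (1 - ?n / p)"
    proof (rule powr_derivative_bound_imp_diff_bound[OF _ q])
      show "\<exists>D. (?F has_real_derivative D) (at s) \<and> \<bar>D\<bar> \<le> B * s powr - (?n / p)" if "0 < s" "s < 1" for s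
        using cube_average_derivative_bound[OF l u[unfolded Q_def] x[unfolded Q_def] that \<Omega>(1)
            \<Omega>(2)[unfolded Q_def] _ g A(1) A(2)[unfolded Q_def]] p n
        by (auto simp: Q_def B_def)
      have mem: "x + s *\<^sub>R (w - x) \<in> Q" if "0 \<le> s" "s \<le> 1" "w \<in> Q" for s w
      proof -
        have "convex Q" by (simp add: Q_def)
        from convexD_alt[OF this x that(3) that(1,2)] show ?thesis
          by (simp add: algebra_simps)
      qed
      \<comment> \<open>The kernel form is meaningless at \<open>s = 0\<close>, but the average in
        its original form is an integral depending continuously on \<open>s\<close> up to both
        ends.\<close>
      show "continuous_on {0..1} ?F"
        unfolding Q_def
      proof (rule integral_continuous_on_param)
        have "continuous_on ({0..1} \<times> Q) (\<lambda>z. u (x + fst z *\<^sub>R (snd z - x)) * cube_bump ((snd z - a) /\<^sub>R l))"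
          by (intro continuous_intros continuous_on_compose2[OF u]
              continuous_on_compose2[OF continuous_on_cube_bump[of UNIV]]) (auto intro: mem)
        then show "continuous_on ({0..1} \<times> cbox a (a + l *\<^sub>R One))
            (\<lambda>(s, w). u (x + s *\<^sub>R (w - x)) * cube_bump ((w - a) /\<^sub>R l))"
          by (simp add: Q_def case_prod_unfold)
      qed
    qed
    moreover have "?F 0 = u x * (l ^ DIM('a) * I0)"
      using integral_scaled_cube_bump[OF l, of a] by (simp add: Q_def I0_def)
    moreover have "?F 1 = integral Q (\<lambda>w. u w * cube_bump ((w - a) /\<^sub>R l))"
      by simp
    ultimately show ?thesis by (simp only:)
  qed
  have "\<bar>u x - u y\<bar> * (l ^ DIM('a) * I0) = \<bar>u x * (l ^ DIM('a) * I0) - u y * (l ^ DIM('a) * I0)\<bar>"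
    using l I0 by (simp add: abs_mult left_diff_distrib[symmetric])
  also have "\<dots> \<le> 2 * (B / (1 - ?n / p))"
    using avg[OF x] avg[OF y] by linarith
  finally have "\<bar>u x - u y\<bar> * (l ^ DIM('a) * I0) \<le> 2 * (B / (1 - ?n / p))" .
  moreover have "0 < l ^ DIM('a) * I0" using l I0 by simp
  ultimately have "\<bar>u x - u y\<bar> \<le> 2 * (B / (1 - ?n / p)) / (l ^ DIM('a) * I0)"
    by (simp only: pos_le_divide_eq)
  also have "\<dots> = morrey_const TYPE('a) p * (l powr (1 + ?n - ?n / p) / l powr ?n) * A powr (1 / p)"
    using l by (simp add: B_def morrey_const_def I0_def powr_realpow mult_ac)
  also have "l powr (1 + ?n - ?n / p) / l powr ?n = l powr (1 - ?n / p)"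
    by (simp add: powr_diff[symmetric])
  finally show ?thesis .
qed

subsection \<open>Covers and dyadic cubes\<close>

definition admissible :: "real \<Rightarrow> 'a::metric_space set \<Rightarrow> real \<Rightarrow> bool" where
  "admissible \<theta> A s \<longleftrightarrow>
     (\<forall>\<epsilon>>0. \<exists>\<delta>0>0. \<forall>\<delta>. 0 < \<delta> \<and> \<delta> \<le> \<delta>0 \<longrightarrow>
          (\<exists>I C. theta_cover \<theta> \<delta> A I C \<and>
             (\<lambda>i. diameter (C i) powr s) summable_on I \<and>
             (\<Sum>\<^sub>\<infinity>i\<in>I. diameter (C i) powr s) < \<epsilon>))"

lemma upper_intermediate_dim_eq:
  "upper_intermediate_dim \<theta> A = Inf {s. s > 0 \<and> admissible \<theta> A s}"
  unfolding upper_intermediate_dim_def admissible_def ..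

text \<open>A bound by a positive power of \<open>\<delta>\<close> falls below every
  \<open>\<epsilon>\<close>. Balls are convenient because their diameter is twice the radius, so
  both diameter bounds become bounds on radii.\<close>

lemma admissible_of_ball_covers:
  fixes A :: "'a::euclidean_space set" and K \<kappa> \<tau> :: real
  assumes \<kappa>: "0 < \<kappa>" and K: "0 < K" and \<tau>: "0 < \<tau>"
    and cover: "\<And>\<delta>. 0 < \<delta> \<Longrightarrow> \<delta> \<le> \<tau> \<Longrightarrow> \<exists>(P :: 'b set) c \<rho>. finite P \<and>
      A \<subseteq> (\<Union>q\<in>P. cball (c q) (\<rho> q)) \<and> (\<forall>q\<in>P. \<delta> powr (1 / \<theta>) \<le> 2 * \<rho> q \<and> 2 * \<rho> q \<le> \<delta>) \<and>
      (\<Sum>q\<in>P. (2 * \<rho> q) powr s) \<le> K * \<delta> powr \<kappa>"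
  shows "admissible \<theta> A s"
  unfolding admissible_def
proof (intro allI impI)
  fix \<epsilon> :: real assume \<epsilon>: "0 < \<epsilon>"
  \<comment> \<open>The second entry solves
    \<open>K * \<delta> powr \<kappa> = \<epsilon> / 2\<close>.\<close>
  define \<delta>0 where "\<delta>0 = min \<tau> ((\<epsilon> / (2 * K)) powr (1 / \<kappa>))"
  show "\<exists>\<delta>0>0. \<forall>\<delta>. 0 < \<delta> \<and> \<delta> \<le> \<delta>0 \<longrightarrow>
          (\<exists>I C. theta_cover \<theta> \<delta> A I C \<and>
             (\<lambda>i. diameter (C i) powr s) summable_on I \<and>
             (\<Sum>\<^sub>\<infinity>i\<in>I. diameter (C i) powr s) < \<epsilon>)"
  proof (intro exI[of _ \<delta>0] conjI allI impI)
    show "0 < \<delta>0" using \<epsilon> K \<tau> by (simp add: \<delta>0_def)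
    fix \<delta> :: real assume \<delta>: "0 < \<delta> \<and> \<delta> \<le> \<delta>0"
    then have "\<delta> \<le> \<tau>" by (simp add: \<delta>0_def)
    with cover[of \<delta>] \<delta> obtain P :: "'b set" and c \<rho> where P: "finite P" "A \<subseteq> (\<Union>q\<in>P. cball (c q) (\<rho> q))"
      "\<And>q. q \<in> P \<Longrightarrow> \<delta> powr (1 / \<theta>) \<le> 2 * \<rho> q \<and> 2 * \<rho> q \<le> \<delta>"
      "(\<Sum>q\<in>P. (2 * \<rho> q) powr s) \<le> K * \<delta> powr \<kappa>"
      by blast
    obtain h where h: "bij_betw h {0..<card P} P"
      using ex_bij_betw_nat_finite[OF P(1)] by blast
    define C where "C i = cball (c (h i)) (\<rho> (h i))" for i
    have hP: "h i \<in> P" if "i \<in> {0..<card P}" for i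
      using h that by (auto simp: bij_betw_def)
    have diam: "diameter (C i) = 2 * \<rho> (h i)" if "i \<in> {0..<card P}" for i
    proof -
      have "0 \<le> \<rho> (h i)"
        using P(3)[OF hP[OF that]] powr_ge_zero[of \<delta> "1 / \<theta>"] by linarith
      then show ?thesis by (simp add: C_def)
    qed
    have cov: "theta_cover \<theta> \<delta> A {0..<card P} C"
      unfolding theta_cover_def
    proof (intro conjI ballI)
      have "(\<Union>i\<in>{0..<card P}. C i) = (\<Union>q\<in>h ` {0..<card P}. cball (c q) (\<rho> q))"
        by (simp add: C_def)
      then show "A \<subseteq> (\<Union>i\<in>{0..<card P}. C i)"
        using P(2) bij_betw_imp_surj_on[OF h] by simp
    qed (use diam P(3) hP in \<open>auto simp: C_def\<close>)
    have summ: "(\<lambda>i. diameter (C i) powr s) summable_on {0..<card P}"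
      by simp
    have "(\<Sum>\<^sub>\<infinity>i\<in>{0..<card P}. diameter (C i) powr s) = (\<Sum>i\<in>{0..<card P}. (2 * \<rho> (h i)) powr s)"
      using diam by simp
    also have "\<dots> = (\<Sum>q\<in>P. (2 * \<rho> q) powr s)"
      by (rule sum.reindex_bij_betw[OF h])
    also have "\<dots> \<le> K * \<delta> powr \<kappa>" by (rule P)
    also have "\<dots> \<le> K * ((\<epsilon> / (2 * K)) powr (1 / \<kappa>)) powr \<kappa>"
      using \<delta> K \<kappa> by (intro mult_left_mono powr_mono2) (auto simp: \<delta>0_def)
    also have "\<dots> = \<epsilon> / 2"
      using K \<epsilon> \<kappa> by (simp add: powr_powr)
    finally have "(\<Sum>\<^sub>\<infinity>i\<in>{0..<card P}. diameter (C i) powr s) < \<epsilon>"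
      using \<epsilon> by simp
    with cov summ show "\<exists>I C. theta_cover \<theta> \<delta> A I C \<and>
             (\<lambda>i. diameter (C i) powr s) summable_on I \<and>
             (\<Sum>\<^sub>\<infinity>i\<in>I. diameter (C i) powr s) < \<epsilon>"
      by blast
  qed
qed

text \<open>The lower bound on diameters keeps every summand above one positive constant, so a
  convergent sum has finitely many terms.\<close>

lemma finite_theta_cover:
  assumes \<delta>: "0 < \<delta>" and s: "0 \<le> s" and cov: "theta_cover \<theta> \<delta> A I C"
    and sum: "(\<lambda>i. diameter (C i) powr s) summable_on I"
  shows "finite I"
proof (rule ccontr)
  assume "infinite I"
  define c where "c = (\<delta> powr (1 / \<theta>)) powr s"
  have c: "0 < c" using \<delta> by (simp add: c_def)
  let ?S = "\<Sum>\<^sub>\<infinity>i\<in>I. diameter (C i) powr s"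
  obtain N :: nat where N: "?S < real N * c"
    using reals_Archimedean3[OF c] by (metis mult.commute)
  obtain F where F: "finite F" "card F = N" "F \<subseteq> I"
    using infinite_arbitrarily_large[OF \<open>infinite I\<close>] by blast
  have "real N * c = (\<Sum>i\<in>F. c)" using F by simp
  also have "\<dots> \<le> (\<Sum>i\<in>F. diameter (C i) powr s)"
    unfolding c_def using cov F s
    by (intro sum_mono powr_mono2) (auto simp: theta_cover_def)
  also have "\<dots> \<le> ?S"
    by (rule finite_sum_le_infsum[OF sum F(1,3)]) auto
  finally show False using N by simp
qed

section \<open>Half-open dyadic cells, indexed by extensional integer functions\<close>

definition dyadic :: "nat \<Rightarrow> 'a::euclidean_space \<Rightarrow> 'a \<Rightarrow> int" where
  "dyadic k x = (\<lambda>i\<in>Basis. \<lfloor>2 ^ k * (x \<bullet> i)\<rfloor>)"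

text \<open>The center need not be extensional: for \<open>\<lambda>i. 2 * z i\<close> the set
  serves to hold the children of the cell \<open>z\<close>.\<close>

definition near :: "('a::euclidean_space \<Rightarrow> int) \<Rightarrow> ('a \<Rightarrow> int) set" where
  "near c = PiE Basis (\<lambda>i. {c i - 1..c i + 1})"

lemma finite_near: "finite (near c)"
  by (simp add: near_def finite_PiE)

lemma card_near: "card (near (c :: 'a::euclidean_space \<Rightarrow> int)) = 3 ^ DIM('a)"
  by (simp add: near_def card_PiE)

text \<open>Numbers at distance at most 1 have floors at distance at most 1. Hence a set of diameter
  at most \<open>(1/2) ^ k\<close> meets at most \<open>3 ^ DIM('a)\<close> cells of level
  \<open>k\<close>.\<close>

lemma dyadic_near:
  assumes "dist x y \<le> (1/2) ^ k"
  shows "dyadic k y \<in> near (dyadic k x)"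
proof -
  have "\<bar>\<lfloor>2 ^ k * (y \<bullet> i)\<rfloor> - \<lfloor>2 ^ k * (x \<bullet> i)\<rfloor>\<bar> \<le> 1" if i: "i \<in> Basis" for i
  proof -
    have "\<bar>(y - x) \<bullet> i\<bar> \<le> (1/2) ^ k"
      using Basis_le_norm[OF i, of "y - x"] assms by (simp add: dist_norm norm_minus_commute)
    then have "2 ^ k * \<bar>(y - x) \<bullet> i\<bar> \<le> 2 ^ k * (1/2) ^ k"
      by (intro mult_left_mono) auto
    then have "\<bar>2 ^ k * (y \<bullet> i) - 2 ^ k * (x \<bullet> i)\<bar> \<le> 1"
      by (simp add: inner_simps power_one_over abs_mult right_diff_distrib[symmetric])
    then show ?thesis by linarith
  qed
  then show ?thesis
    by (auto simp: near_def dyadic_def abs_le_iff PiE_iff restrict_extensional) (smt (verit))+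
qed

text \<open>The coordinates of a child are in fact \<open>2 * z i\<close> or
  \<open>2 * z i + 1\<close>; the larger set makes the count \<open>card_near\<close>
  available.\<close>

lemma dyadic_Suc_near: "dyadic (Suc k) x \<in> near (\<lambda>i. 2 * dyadic k x i)"
proof -
  have "2 * \<lfloor>2 ^ k * (x \<bullet> i)\<rfloor> - 1 \<le> \<lfloor>2 ^ Suc k * (x \<bullet> i)\<rfloor> \<and>
      \<lfloor>2 ^ Suc k * (x \<bullet> i)\<rfloor> \<le> 2 * \<lfloor>2 ^ k * (x \<bullet> i)\<rfloor> + 1" for i
    by simp linarith
  then show ?thesis
    by (auto simp: near_def dyadic_def PiE_iff restrict_extensional)
qed

lemma finite_dyadic_image:
  fixes E :: "'a::euclidean_space set"
  assumes "bounded E"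
  shows "finite (dyadic k ` E)"
proof -
  obtain R where R: "\<And>x. x \<in> E \<Longrightarrow> norm x \<le> R"
    using assms by (auto simp: bounded_iff)
  have "dyadic k ` E \<subseteq> PiE Basis (\<lambda>i. {\<lfloor>- (2 ^ k * R)\<rfloor>..\<lceil>2 ^ k * R\<rceil>})"
  proof (rule image_subsetI)
    fix x assume x: "x \<in> E"
    have "\<lfloor>- (2 ^ k * R)\<rfloor> \<le> \<lfloor>2 ^ k * (x \<bullet> i)\<rfloor> \<and> \<lfloor>2 ^ k * (x \<bullet> i)\<rfloor> \<le> \<lceil>2 ^ k * R\<rceil>" if i: "i \<in> Basis" for i
    proof -
      have "\<bar>x \<bullet> i\<bar> \<le> R"
        using Basis_le_norm[OF i, of x] R[OF x] by linarith
      then have "2 ^ k * \<bar>x \<bullet> i\<bar> \<le> 2 ^ k * R" by (intro mult_left_mono) auto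
      then have "\<bar>2 ^ k * (x \<bullet> i)\<bar> \<le> 2 ^ k * R" by (simp add: abs_mult)
      then have "- (2 ^ k * R) \<le> 2 ^ k * (x \<bullet> i)" "2 ^ k * (x \<bullet> i) \<le> 2 ^ k * R" by linarith+
      then show ?thesis by linarith
    qed
    then show "dyadic k x \<in> PiE Basis (\<lambda>i. {\<lfloor>- (2 ^ k * R)\<rfloor>..\<lceil>2 ^ k * R\<rceil>})"
      by (simp add: dyadic_def PiE_iff restrict_extensional)
  qed
  then show ?thesis
    by (rule finite_subset) (simp add: finite_PiE)
qed

text \<open>A geometric series with ratio \<open>(1/2) powr \<eta>\<close>, controlled by its
  largest term, the one at the least element of \<open>K\<close>.\<close>

lemma sum_halves_powr_le:
  fixes \<tau> \<eta> :: real
  assumes K: "finite K" "\<And>k. k \<in> K \<Longrightarrow> (1/2) ^ k \<le> \<tau>" and \<eta>: "0 < \<eta>"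
  shows "(\<Sum>k\<in>K. ((1/2) ^ k) powr \<eta>) \<le> \<tau> powr \<eta> / (1 - (1/2) powr \<eta>)"
proof -
  define r :: real where "r = (1/2) powr \<eta>"
  have "r < 1 powr \<eta>" unfolding r_def by (rule powr_less_mono2) (use \<eta> in auto)
  then have r: "0 < r" "r < 1" by (auto simp: r_def)
  have rk: "((1/2) ^ k) powr \<eta> = r ^ k" for k :: nat
    by (simp add: r_def powr_powr powr_realpow[symmetric] mult.commute)
  show ?thesis
  proof (cases "K = {}")
    case False
    define m where "m = Min K"
    have m: "m \<in> K" "\<And>k. k \<in> K \<Longrightarrow> m \<le> k" using False K by (auto simp: m_def)
    have "(\<Sum>k\<in>K. r ^ k) = (\<Sum>k\<in>K. r ^ m * r ^ (k - m))"
      using m by (intro sum.cong) (auto simp: power_add[symmetric])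
    also have "\<dots> = r ^ m * (\<Sum>j\<in>(\<lambda>k. k - m) ` K. r ^ j)"
    proof -
      have "inj_on (\<lambda>k. k - m) K"
        using m by (intro inj_onI) (metis le_add_diff_inverse)
      then show ?thesis by (simp add: sum.reindex sum_distrib_left)
    qed
    also have "\<dots> \<le> r ^ m * (\<Sum>j. r ^ j)"
      using K r by (intro mult_left_mono sum_le_suminf) (auto simp: summable_geometric)
    also have "\<dots> = r ^ m / (1 - r)"
      using r by (simp add: suminf_geometric)
    also have "\<dots> \<le> \<tau> powr \<eta> / (1 - r)"
      using powr_mono2[of \<eta> "(1/2) ^ m" \<tau>] K(2)[OF m(1)] \<eta> r
      by (intro divide_right_mono) (auto simp: rk)
    finally show ?thesis
      by (simp add: rk r_def)
  qed (use r in \<open>simp add: r_def\<close>)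
qed

lemma sum_UN_le:
  fixes h :: "'b \<Rightarrow> real"
  assumes "finite I" "\<And>i. i \<in> I \<Longrightarrow> finite (G i)" "\<And>q. 0 \<le> h q"
  shows "(\<Sum>q\<in>(\<Union>i\<in>I. G i). h q) \<le> (\<Sum>i\<in>I. \<Sum>q\<in>G i. h q)"
  using assms
proof (induction I rule: finite_induct)
  case (insert i I)
  have "sum h (G i \<union> (\<Union>i\<in>I. G i)) + sum h (G i \<inter> (\<Union>i\<in>I. G i)) = sum h (G i) + sum h (\<Union>i\<in>I. G i)"
    by (rule sum.union_inter) (use insert in auto)
  moreover have "0 \<le> sum h (G i \<inter> (\<Union>i\<in>I. G i))"
    by (intro sum_nonneg insert)
  ultimately show ?case
    using insert by force
qed simp

text \<open>The level just before the powers of 1/2 first drop below \<open>d\<close>;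
  \<open>d \<le> 1\<close> ensures that there is one.\<close>

lemma obtain_dyadic_scale:
  fixes d :: real
  assumes "0 < d" "d \<le> 1"
  obtains k :: nat where "d \<le> (1/2) ^ k" "(1/2) ^ k < 2 * d"
proof -
  have ex: "\<exists>k. (1/2 :: real) ^ k < d"
    using assms by (intro real_arch_pow_inv) auto
  define m where "m = (LEAST k. (1/2 :: real) ^ k < d)"
  have m: "(1/2 :: real) ^ m < d"
    unfolding m_def by (rule LeastI_ex[OF ex])
  then obtain k where k: "m = Suc k"
    using assms by (cases m) auto
  have "\<not> (1/2 :: real) ^ k < d"
    using not_less_Least[of k "\<lambda>k. (1/2 :: real) ^ k < d"] k by (simp add: m_def)
  with m k that[of k] show ?thesis by auto
qed

text \<open>Closed, unlike the cells indexed by \<open>dyadic\<close>, because Morrey's inequality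
  was proved on closed cubes. The price is overlap along the faces.\<close>

definition dyadic_cube :: "nat \<Rightarrow> ('a::euclidean_space \<Rightarrow> int) \<Rightarrow> 'a set" where
  "dyadic_cube k z = (let c = (\<Sum>i\<in>Basis. (z i * (1/2) ^ k) *\<^sub>R i) in cbox c (c + (1/2) ^ k *\<^sub>R One))"

lemma mem_dyadic_cube:
  fixes y :: "'a::euclidean_space"
  shows "y \<in> dyadic_cube k z \<longleftrightarrow> (\<forall>i\<in>Basis. real_of_int (z i) \<le> 2 ^ k * (y \<bullet> i) \<and> 2 ^ k * (y \<bullet> i) \<le> z i + 1)"
proof -
  have "y \<in> dyadic_cube k z \<longleftrightarrow> (\<forall>i\<in>Basis. z i * (1/2) ^ k \<le> y \<bullet> i \<and> y \<bullet> i \<le> z i * (1/2) ^ k + (1/2) ^ k)"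
    by (simp add: dyadic_cube_def Let_def mem_box inner_simps inner_sum_left inner_Basis if_distrib cong: if_cong)
  also have "\<dots> \<longleftrightarrow> (\<forall>i\<in>Basis. real_of_int (z i) \<le> 2 ^ k * (y \<bullet> i) \<and> 2 ^ k * (y \<bullet> i) \<le> z i + 1)"
    by (intro ball_cong refl) (simp add: power_one_over field_simps)
  finally show ?thesis .
qed

lemma self_mem_dyadic_cube: "x \<in> dyadic_cube k (dyadic k x)"
  by (auto simp: mem_dyadic_cube dyadic_def)

lemma dist_le_dyadic_cube:
  fixes x y :: "'a::euclidean_space"
  assumes "x \<in> dyadic_cube k z" "y \<in> dyadic_cube k z"
  shows "dist x y \<le> real DIM('a) * (1/2) ^ k"
proof -
  have "\<bar>(x - y) \<bullet> i\<bar> \<le> (1/2) ^ k" if i: "i \<in> Basis" for i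
  proof -
    have "\<bar>2 ^ k * (x \<bullet> i) - 2 ^ k * (y \<bullet> i)\<bar> \<le> 1"
      using assms i by (force simp: mem_dyadic_cube)
    then have "2 ^ k * \<bar>(x - y) \<bullet> i\<bar> \<le> 1"
      by (simp add: inner_simps right_diff_distrib[symmetric] abs_mult)
    then show ?thesis
      by (simp add: power_one_over pos_le_divide_eq mult.commute)
  qed
  then have "(\<Sum>i\<in>Basis. \<bar>(x - y) \<bullet> i\<bar>) \<le> (\<Sum>i\<in>(Basis::'a set). (1/2) ^ k)"
    by (intro sum_mono)
  then show ?thesis
    using norm_le_l1[of "x - y"] by (simp add: dist_norm)
qed

lemma dyadic_cube_near:
  assumes "y \<in> dyadic_cube k z" "z \<in> extensional Basis"
  shows "z \<in> near (dyadic k y)"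
proof -
  have "\<lfloor>2 ^ k * (y \<bullet> i)\<rfloor> - 1 \<le> z i \<and> z i \<le> \<lfloor>2 ^ k * (y \<bullet> i)\<rfloor> + 1" if i: "i \<in> Basis" for i
  proof -
    have "real_of_int (z i) \<le> 2 ^ k * (y \<bullet> i)" "2 ^ k * (y \<bullet> i) \<le> z i + 1"
      using assms(1) i by (auto simp: mem_dyadic_cube)
    then show ?thesis by linarith
  qed
  then show ?thesis using assms(2) by (simp add: near_def PiE_iff dyadic_def)
qed

lemma measure_dyadic_cube:
  "measure lebesgue (dyadic_cube k (z :: 'a::euclidean_space \<Rightarrow> int)) = ((1/2) ^ k) ^ DIM('a)"
proof -
  define c where "c = (\<Sum>i\<in>(Basis::'a set). (z i * (1/2) ^ k) *\<^sub>R i)"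
  have "measure lebesgue (cbox c (c + (1/2) ^ k *\<^sub>R One)) = (\<Prod>i\<in>(Basis::'a set). (1/2) ^ k)"
    by (subst measure_completion, simp, subst measure_lborel_cbox_eq) (auto simp: inner_simps)
  then show ?thesis by (simp add: dyadic_cube_def Let_def c_def)
qed

lemma dyadic_cube_lmeasurable: "dyadic_cube k z \<in> lmeasurable"
  by (simp add: dyadic_cube_def Let_def)

text \<open>Bounded overlap: all indices of closed cubes containing \<open>y\<close> lie in
  \<open>near (dyadic k y)\<close>. Extensionality is what makes these indices countable
  there.\<close>

lemma sum_indicator_dyadic_cube_le:
  fixes Z :: "('a::euclidean_space \<Rightarrow> int) set"
  assumes "finite Z" "Z \<subseteq> extensional Basis"
  shows "(\<Sum>z\<in>Z. indicator (dyadic_cube k z) y :: real) \<le> 3 ^ DIM('a)"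
proof -
  have "(\<Sum>z\<in>Z. indicator (dyadic_cube k z) y :: real) = real (card {z \<in> Z. y \<in> dyadic_cube k z})"
    using assms(1) by (simp add: indicator_def of_bool_def sum.If_cases Int_def)
  also have "\<dots> \<le> real (card (near (dyadic k y)))"
    using assms(2) dyadic_cube_near[of y k] by (intro of_nat_mono card_mono finite_near) auto
  finally show ?thesis by (simp add: card_near)
qed

lemma morrey_const_pos: "real DIM('a) < p \<Longrightarrow> 0 < morrey_const TYPE('a::euclidean_space) p"
  unfolding morrey_const_def
  by (intro divide_pos_pos integral_cube_bump_pos) (auto simp: field_simps intro: order_less_trans[of 0])

subsection \<open>Distortion of covers\<close>

text \<open>
  Only the cubes that meet \<open>E\<close> are relevant, at levels so fine that they lie inside the domain of the
  map. The term 1 in \<open>1 + |Df|\<close> to the power \<open>p\<close> gives the last assumption, which makes \<open>a\<close> positive.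
\<close>

locale dyadic_energy =
  fixes E :: "'a::euclidean_space set" and f :: "'a \<Rightarrow> 'b::euclidean_space"
    and a :: "nat \<Rightarrow> ('a \<Rightarrow> int) \<Rightarrow> real" and p C M :: real and k0 :: nat
  assumes p: "real DIM('a) < p" and C: "0 < C" and M: "0 < M" and E: "bounded E"
    and dist_le: "\<And>k x y. k0 \<le> k \<Longrightarrow> x \<in> E \<Longrightarrow> y \<in> E \<Longrightarrow> dyadic k x = dyadic k y \<Longrightarrow>
      dist (f x) (f y) \<le> C * ((1/2) ^ k) powr (1 - real DIM('a) / p) * a k (dyadic k x) powr (1 / p)"
    and sum_le: "\<And>k. k0 \<le> k \<Longrightarrow> (\<Sum>z\<in>dyadic k ` E. a k z) \<le> M"
    and ge: "\<And>k z. k0 \<le> k \<Longrightarrow> z \<in> dyadic k ` E \<Longrightarrow> ((1/2) ^ k) ^ DIM('a) \<le> a k z"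
begin

section \<open>Costs of the images of cells\<close>

definition \<gamma> where "\<gamma> = 1 - real DIM('a) / p"

text \<open>The right-hand side of \<open>dist_le\<close>, used in place of the diameter of the
  image of a cell.\<close>

definition D where "D k z = C * ((1/2) ^ k) powr \<gamma> * a k z powr (1 / p)"

lemma p_pos: "1 < p" "0 < p"
proof -
  have "1 \<le> real DIM('a)" by (simp add: Suc_leI)
  then show "1 < p" "0 < p" using p by linarith+
qed

lemma \<gamma>: "0 < \<gamma>" "\<gamma> * p = p - real DIM('a)"
  using p p_pos by (auto simp: \<gamma>_def field_simps)

lemma a_pos: "k0 \<le> k \<Longrightarrow> z \<in> dyadic k ` E \<Longrightarrow> 0 < a k z"
  using ge[of k z] by (smt (verit) zero_less_power half_gt_zero_iff)

lemma a_le: "k0 \<le> k \<Longrightarrow> z \<in> dyadic k ` E \<Longrightarrow> a k z \<le> M"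
  using sum_le[of k] member_le_sum[of z "dyadic k ` E" "a k"] a_pos[of k] finite_dyadic_image[OF E, of k]
  by (smt (verit) DiffD1)

lemma D_nonneg: "0 \<le> D k z"
  using C by (simp add: D_def)

lemma D_le: "k0 \<le> k \<Longrightarrow> z \<in> dyadic k ` E \<Longrightarrow> D k z \<le> C * M powr (1 / p) * ((1/2) ^ k) powr \<gamma>"
  using a_le[of k z] a_pos[of k z] C p_pos
  by (auto simp: D_def mult.assoc mult.commute[of _ "_ powr \<gamma>"] intro!: mult_left_mono powr_mono2)

text \<open>The exponent \<open>t\<close> is spent on Young's inequality. The excess
  \<open>\<eta>\<close> meets only the crude bound \<open>D_le\<close> and leaves the power of the
  side that makes sums over levels converge.\<close>

lemma D_powr_le:
  assumes k: "k0 \<le> k" and z: "z \<in> dyadic k ` E" and s: "0 < s"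
    and t: "t = p * s / (p - real DIM('a) + s)" and \<eta>: "0 < \<eta>"
  shows "(2 * D k z) powr (t + \<eta>) \<le>
    (2 * C) powr t * (2 * C * M powr (1 / p)) powr \<eta> * ((((1/2) ^ k) powr s + a k z) * ((1/2) ^ k) powr (\<gamma> * \<eta>))"
proof -
  let ?w = "(1/2 :: real) ^ k"
  have w: "0 < ?w" by simp
  note az = a_pos[OF k z]
  have den: "0 < p - real DIM('a) + s" using p s by simp
  have t0: "0 < t" "t < p"
    using den p s p_pos by (auto simp: t field_simps)
  \<comment> \<open>This identity singles out the value of \<open>t\<close>: it turns the product
    into one with the conjugate weights \<open>1 - t / p\<close> and \<open>t / p\<close>.\<close>
  have expo: "\<gamma> * t = s * (1 - t / p)"
  proof -
    have "\<gamma> * t = (\<gamma> * p) * s / (p - real DIM('a) + s)" by (simp add: t)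
    also have "\<dots> = s * (1 - s / (p - real DIM('a) + s))" using den by (simp only: \<gamma>) (simp add: field_simps)
    also have "s / (p - real DIM('a) + s) = t / p" using p_pos by (simp add: t)
    finally show ?thesis .
  qed
  have "(2 * D k z) powr t = (2 * C) powr t * (?w powr (\<gamma> * t) * a k z powr (t / p))"
    using C az by (simp add: D_def powr_mult powr_powr algebra_simps)
  also have "?w powr (\<gamma> * t) * a k z powr (t / p) = (?w powr s) powr (1 - t / p) * a k z powr (t / p)"
    by (simp only: expo powr_powr)
  also have "\<dots> \<le> (1 - t / p) * ?w powr s + t / p * a k z"
    using Youngs_inequality_0[of "1 - t / p" "t / p" "?w powr s" "a k z"] t0 az p_pos by simp
  also have "\<dots> \<le> 1 * ?w powr s + 1 * a k z"
    using t0 az p_pos by (intro add_mono mult_right_mono) auto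
  finally have 1: "(2 * D k z) powr t \<le> (2 * C) powr t * (?w powr s + a k z)"
    using C by (simp add: mult_left_mono)
  have "(2 * D k z) powr \<eta> \<le> (2 * (C * M powr (1 / p) * ?w powr \<gamma>)) powr \<eta>"
    using D_le[OF k z] D_nonneg[of k z] \<eta> by (intro powr_mono2) auto
  also have "\<dots> = (2 * C * M powr (1 / p)) powr \<eta> * ?w powr (\<gamma> * \<eta>)"
    using C M by (simp add: powr_mult powr_powr algebra_simps)
  finally have 2: "(2 * D k z) powr \<eta> \<le> (2 * C * M powr (1 / p)) powr \<eta> * ?w powr (\<gamma> * \<eta>)" .
  have "(2 * D k z) powr (t + \<eta>) = (2 * D k z) powr t * (2 * D k z) powr \<eta>"
    by (rule powr_add)
  also have "\<dots> \<le> ((2 * C) powr t * (?w powr s + a k z)) * ((2 * C * M powr (1 / p)) powr \<eta> * ?w powr (\<gamma> * \<eta>))"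
    using az by (intro mult_mono 1 2) auto
  finally show ?thesis by (simp add: mult_ac)
qed

text \<open>The two terms of \<open>D_powr_le\<close> are summed differently: the powers of sides
  are charged to the covering sets, with at most \<open>3 ^ DIM('a)\<close> cells each, and the
  energies are summed level by level, each level costing at most \<open>M\<close>.\<close>

lemma sum_D_powr_le:
  assumes s: "0 < s" and t: "t = p * s / (p - real DIM('a) + s)" and \<eta>: "0 < \<eta>"
    and I: "finite I" and lev: "\<And>i. i \<in> I \<Longrightarrow> k0 \<le> lev i" "\<And>i. i \<in> I \<Longrightarrow> (1/2) ^ lev i \<le> 2 * d i"
    and d: "\<And>i. i \<in> I \<Longrightarrow> d i \<le> \<delta>" "(\<Sum>i\<in>I. d i powr s) \<le> 1"
    and G: "\<And>i. i \<in> I \<Longrightarrow> G i \<subseteq> {lev i} \<times> dyadic (lev i) ` E" "\<And>i. i \<in> I \<Longrightarrow> card (G i) \<le> 3 ^ DIM('a)"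
  shows "(\<Sum>(k, z)\<in>(\<Union>i\<in>I. G i). (2 * D k z) powr (t + \<eta>)) \<le>
    (2 * C) powr t * (2 * C * M powr (1 / p)) powr \<eta> *
      (3 ^ DIM('a) * 2 powr s + M / (1 - (1/2) powr (\<gamma> * \<eta>))) * (2 * \<delta>) powr (\<gamma> * \<eta>)"
proof -
  let ?w = "\<lambda>k. (1/2 :: real) ^ k"
  let ?U = "\<Union>i\<in>I. G i"
  let ?c = "(2 * C) powr t * (2 * C * M powr (1 / p)) powr \<eta>"
  have \<gamma>\<eta>: "0 < \<gamma> * \<eta>" using \<gamma> \<eta> by simp
  have finG: "finite (G i)" if "i \<in> I" for i
    by (rule finite_subset[OF G(1)[OF that]]) (simp add: finite_dyadic_image[OF E])
  have finU: "finite ?U" using I finG by blast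
  have U: "k0 \<le> k" "z \<in> dyadic k ` E" "k \<in> lev ` I" if "(k, z) \<in> ?U" for k z
    using that G(1) lev(1) by (blast, blast, blast)
  have wle: "?w k \<le> 2 * \<delta>" if "k \<in> lev ` I" for k
    using that lev(2) d(1) by force
  have "(\<Sum>(k, z)\<in>?U. (2 * D k z) powr (t + \<eta>)) \<le>
      (\<Sum>(k, z)\<in>?U. ?c * ((?w k powr s + a k z) * ?w k powr (\<gamma> * \<eta>)))"
    by (rule sum_mono) (use D_powr_le[OF U(1,2) s t \<eta>] in force)
  also have "\<dots> = ?c * ((\<Sum>(k, z)\<in>?U. ?w k powr s * ?w k powr (\<gamma> * \<eta>)) + (\<Sum>(k, z)\<in>?U. a k z * ?w k powr (\<gamma> * \<eta>)))"
    by (simp add: sum_distrib_left sum.distrib[symmetric] case_prod_unfold algebra_simps)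
  also have "\<dots> \<le> ?c * (3 ^ DIM('a) * 2 powr s * (2 * \<delta>) powr (\<gamma> * \<eta>) + M * ((2 * \<delta>) powr (\<gamma> * \<eta>) / (1 - (1/2) powr (\<gamma> * \<eta>))))"
  proof (intro mult_left_mono add_mono)
    have "(\<Sum>(k, z)\<in>?U. ?w k powr s * ?w k powr (\<gamma> * \<eta>)) \<le> (\<Sum>(k, z)\<in>?U. ?w k powr s * (2 * \<delta>) powr (\<gamma> * \<eta>))"
      using U(3) wle \<gamma>\<eta> by (intro sum_mono) (auto intro!: mult_left_mono powr_mono2)
    also have "\<dots> = (\<Sum>q\<in>?U. ?w (fst q) powr s) * (2 * \<delta>) powr (\<gamma> * \<eta>)"
      by (simp add: sum_distrib_right case_prod_unfold)
    also have "(\<Sum>q\<in>?U. ?w (fst q) powr s) \<le> (\<Sum>i\<in>I. \<Sum>q\<in>G i. ?w (fst q) powr s)"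
      by (rule sum_UN_le[OF I finG]) auto
    also have "\<dots> \<le> (\<Sum>i\<in>I. 3 ^ DIM('a) * (2 powr s * d i powr s))"
    proof (rule sum_mono)
      fix i assume i: "i \<in> I"
      have "(\<Sum>q\<in>G i. ?w (fst q) powr s) = (\<Sum>q\<in>G i. ?w (lev i) powr s)"
        using G(1)[OF i] by (intro sum.cong) auto
      also have "\<dots> = real (card (G i)) * ?w (lev i) powr s" by simp
      also have "\<dots> \<le> real (3 ^ DIM('a)) * (2 * d i) powr s"
        using G(2)[OF i] lev(2)[OF i] s by (intro mult_mono powr_mono2 of_nat_mono) auto
      also have "(2 * d i) powr s = 2 powr s * d i powr s"
        by (rule powr_mult)
      finally show "(\<Sum>q\<in>G i. ?w (fst q) powr s) \<le> 3 ^ DIM('a) * (2 powr s * d i powr s)" by simp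
    qed
    also have "\<dots> = 3 ^ DIM('a) * 2 powr s * (\<Sum>i\<in>I. d i powr s)"
      by (simp add: sum_distrib_left mult.assoc)
    also have "\<dots> \<le> 3 ^ DIM('a) * 2 powr s * 1"
      using d(2) by (intro mult_left_mono) auto
    finally show "(\<Sum>(k, z)\<in>?U. ?w k powr s * ?w k powr (\<gamma> * \<eta>)) \<le> 3 ^ DIM('a) * 2 powr s * (2 * \<delta>) powr (\<gamma> * \<eta>)"
      by (simp add: mult_right_mono)
  next
    \<comment> \<open>A union counts each cell once, however many covering sets it meets, so it may
      be enlarged to all cells of the levels that occur.\<close>
    have "(\<Sum>(k, z)\<in>?U. a k z * ?w k powr (\<gamma> * \<eta>)) \<le>
        (\<Sum>(k, z)\<in>Sigma (lev ` I) (\<lambda>k. dyadic k ` E). a k z * ?w k powr (\<gamma> * \<eta>))"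
    proof (rule sum_mono2)
      show "?U \<subseteq> Sigma (lev ` I) (\<lambda>k. dyadic k ` E)"
        using G(1) by fastforce
    qed (use I finite_dyadic_image[OF E] a_pos lev(1) in \<open>auto intro!: mult_nonneg_nonneg less_imp_le\<close>)
    also have "\<dots> = (\<Sum>k\<in>lev ` I. (\<Sum>z\<in>dyadic k ` E. a k z) * ?w k powr (\<gamma> * \<eta>))"
      using I finite_dyadic_image[OF E] by (simp add: sum.Sigma[symmetric] sum_distrib_right)
    also have "\<dots> \<le> (\<Sum>k\<in>lev ` I. M * ?w k powr (\<gamma> * \<eta>))"
      using sum_le lev(1) by (intro sum_mono mult_right_mono) auto
    also have "\<dots> = M * (\<Sum>k\<in>lev ` I. ?w k powr (\<gamma> * \<eta>))"
      by (simp add: sum_distrib_left)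
    also have "\<dots> \<le> M * ((2 * \<delta>) powr (\<gamma> * \<eta>) / (1 - (1/2) powr (\<gamma> * \<eta>)))"
      using M I wle \<gamma>\<eta> by (intro mult_left_mono sum_halves_powr_le) auto
    finally show "(\<Sum>(k, z)\<in>?U. a k z * ?w k powr (\<gamma> * \<eta>)) \<le>
        M * ((2 * \<delta>) powr (\<gamma> * \<eta>) / (1 - (1/2) powr (\<gamma> * \<eta>)))" .
  qed (use C M in auto)
  finally show ?thesis by (simp add: algebra_simps)
qed

section \<open>Cells whose image may be too large\<close>

definition bad :: "real \<Rightarrow> nat \<Rightarrow> ('a \<Rightarrow> int) set" where
  "bad r k = {z \<in> dyadic k ` E. r < D k z}"

lemma finite_bad: "finite (bad r k)"
  unfolding bad_def using finite_dyadic_image[OF E] by simp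

text \<open>A Chebyshev argument: \<open>r < D k z\<close> forces a definite amount of energy in the
  cell, and the energies of one level add up to at most \<open>M\<close>.\<close>

lemma card_bad_le:
  assumes k: "k0 \<le> k" and r: "0 < r"
  shows "real (card (bad r k)) \<le> (C / r) powr p * M * ((1/2) ^ k) powr (p - real DIM('a))"
proof -
  let ?w = "(1/2 :: real) ^ k"
  have "1 \<le> (C / r) powr p * ?w powr (p - real DIM('a)) * a k z" if z: "z \<in> bad r k" for z
  proof -
    have zE: "z \<in> dyadic k ` E" and less: "r < D k z" using z by (auto simp: bad_def)
    note az = a_pos[OF k zE]
    have "1 powr p \<le> (D k z / r) powr p"
      using less r p_pos by (intro powr_mono2) auto
    also have "D k z / r = (C / r) * ?w powr \<gamma> * a k z powr (1 / p)"
      by (simp add: D_def)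
    also have "\<dots> powr p = (C / r) powr p * ?w powr (\<gamma> * p) * a k z"
      using C r az p_pos by (simp add: powr_mult powr_divide powr_powr)
    finally show ?thesis by (simp add: \<gamma>)
  qed
  then have "(\<Sum>z\<in>bad r k. 1) \<le> (\<Sum>z\<in>bad r k. (C / r) powr p * ?w powr (p - real DIM('a)) * a k z)"
    by (intro sum_mono)
  also have "\<dots> = (C / r) powr p * ?w powr (p - real DIM('a)) * (\<Sum>z\<in>bad r k. a k z)"
    by (simp add: sum_distrib_left)
  also have "(\<Sum>z\<in>bad r k. a k z) \<le> (\<Sum>z\<in>dyadic k ` E. a k z)"
    using finite_dyadic_image[OF E] a_pos[OF k] by (intro sum_mono2) (auto simp: bad_def intro: less_imp_le)
  also note sum_le[OF k]
  finally show ?thesis using C r by (simp add: mult_ac mult_left_mono)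
qed

text \<open>The energy of a single cell is at most \<open>M\<close> while
  \<open>\<gamma> > 0\<close>, so \<open>D\<close> tends to 0 uniformly with the level and
  subdivision stops.\<close>

lemma eventually_not_bad:
  assumes r: "0 < r"
  obtains K where "\<And>k z. K \<le> k \<Longrightarrow> k0 \<le> k \<Longrightarrow> z \<in> dyadic k ` E \<Longrightarrow> D k z \<le> r"
proof -
  define q where "q = (1/2 :: real) powr \<gamma>"
  have "q < 1 powr \<gamma>" unfolding q_def by (rule powr_less_mono2) (use \<gamma> in auto)
  then have q: "0 < q" "q < 1" by (auto simp: q_def)
  let ?c = "C * M powr (1 / p)"
  have c: "0 < ?c" using C M by simp
  obtain K where K: "q ^ K < r / ?c"
    using real_arch_pow_inv[of "r / ?c" q] q r c by auto
  have "D k z \<le> r" if k: "K \<le> k" "k0 \<le> k" "z \<in> dyadic k ` E" for k z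
  proof -
    have "D k z \<le> ?c * ((1/2) ^ k) powr \<gamma>" by (rule D_le) (use k in auto)
    also have "((1/2 :: real) ^ k) powr \<gamma> = q ^ k"
      by (simp add: q_def powr_powr powr_realpow[symmetric] mult.commute)
    also have "?c * q ^ k \<le> ?c * (r / ?c)"
    proof (rule mult_left_mono)
      have "q ^ k \<le> q ^ K" by (rule power_decreasing[OF k(1)]) (use q in auto)
      then show "q ^ k \<le> r / ?c" using K by linarith
    qed (use c in simp)
    also have "?c * (r / ?c) = r"
      using c by (metis less_irrefl nonzero_mult_div_cancel_left times_divide_eq_right)
    finally show ?thesis .
  qed
  then show ?thesis using that by blast
qed

text \<open>The cover of the image consists of balls for \<open>P1\<close>, the cells from the given
  cover whose images fit, and for \<open>P2\<close>, the fitting children of bad cells. In the final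
  constant, \<open>K1\<close> pays for the images of \<open>P1\<close>, \<open>3 ^ DIM('a)\<close>
  for enlarging balls to the minimal size, and \<open>K2\<close> for \<open>P2\<close>.\<close>

lemma admissible_image:
  assumes \<theta>: "0 < \<theta>" "\<theta> < 1" and s: "0 < s" and adm: "admissible \<theta> E s"
    and t': "p * s / (p - real DIM('a) + s) < t'"
  shows "admissible \<theta> (f ` E) t'"
proof -
  define n where "n = real DIM('a)"
  define t where "t = p * s / (p - n + s)"
  define \<eta> where "\<eta> = t' - t"
  \<comment> \<open>Chosen with \<open>\<alpha> * t = s\<close>, so that
    \<open>\<delta>' = \<delta> powr \<alpha>\<close> gives
    \<open>\<delta>' powr t = \<delta> powr s\<close>.\<close>
  define \<alpha> where "\<alpha> = (p - n + s) / p"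
  have \<eta>: "0 < \<eta>" "t' = t + \<eta>" using t' by (auto simp: \<eta>_def t_def n_def)
  have den: "0 < p - n + s" using p s by (simp add: n_def)
  have \<alpha>: "0 < \<alpha>" "\<alpha> * t = s" "\<alpha> * p = p - n + s"
    using den p_pos by (auto simp: \<alpha>_def t_def)
  have t0: "0 < t" using den s p_pos by (simp add: t_def)
  have \<gamma>\<alpha>: "\<gamma> \<le> \<alpha>" using s p_pos by (simp add: \<alpha>_def \<gamma>_def n_def field_simps)
  have \<gamma>\<eta>: "0 < \<gamma> * \<eta>" using \<gamma> \<eta> by simp
  \<comment> \<open>A bound 1 on the sums suffices; smallness will come from the excess exponent
    \<open>\<eta>\<close>.\<close>
  obtain \<delta>E where \<delta>E: "0 < \<delta>E" "\<And>\<delta>. 0 < \<delta> \<Longrightarrow> \<delta> \<le> \<delta>E \<Longrightarrow> \<exists>I A. theta_cover \<theta> \<delta> E I A \<and>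
      (\<lambda>i. diameter (A i) powr s) summable_on I \<and> (\<Sum>\<^sub>\<infinity>i\<in>I. diameter (A i) powr s) < 1"
    using adm unfolding admissible_def by (metis zero_less_one)
  \<comment> \<open>The cells used have side at most \<open>2 * \<delta>\<close>, hence
    \<open>Suc k0\<close> here to reach levels from \<open>k0\<close> on.\<close>
  define \<delta>2 where "\<delta>2 = min \<delta>E ((1/2) ^ Suc k0)"
  have \<delta>2: "0 < \<delta>2" using \<delta>E by (simp add: \<delta>2_def)
  define K1 where "K1 = (2 * C) powr t * (2 * C * M powr (1 / p)) powr \<eta> *
      (3 ^ DIM('a) * 2 powr s + M / (1 - (1/2) powr (\<gamma> * \<eta>))) * 2 powr (\<gamma> * \<eta>)"
  \<comment> \<open>Children per bad cell, times the count \<open>card_bad_le\<close> with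
    \<open>r = \<delta>' / 2\<close>, summed over all levels of side at most
    \<open>2 * \<delta>\<close>.\<close>
  define K2 where "K2 = 3 ^ DIM('a) * ((2 * C) powr p * M * (2 powr (p - n) / (1 - (1/2) powr (p - n))))"
  have half: "(1/2 :: real) powr x < 1" if "0 < x" for x
    using powr_less_mono2[of x "1/2" 1] that by simp
  have K: "0 \<le> K1" "0 \<le> K2"
    using C M half[OF \<gamma>\<eta>] half[of "p - n"] p by (auto simp: K1_def K2_def n_def intro!: mult_nonneg_nonneg add_nonneg_nonneg)
  have "(0::real) < 3 ^ DIM('a)" by simp
  with K have Kpos: "0 < K1 + 3 ^ DIM('a) + K2" by linarith
  show ?thesis
  proof (rule admissible_of_ball_covers[where \<kappa> = "\<gamma> * \<eta> / \<alpha>" and K = "K1 + 3 ^ DIM('a) + K2" and \<tau> = "\<delta>2 powr \<alpha>"])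
    fix \<delta>' :: real assume \<delta>': "0 < \<delta>'" "\<delta>' \<le> \<delta>2 powr \<alpha>"
    \<comment> \<open>The scale is prescribed in the image and transferred back;
      \<open>\<delta>' powr (\<gamma> * \<eta> / \<alpha>)\<close> is then
      \<open>\<delta> powr (\<gamma> * \<eta>)\<close>.\<close>
    define \<delta> where "\<delta> = \<delta>' powr (1 / \<alpha>)"
    have \<delta>: "0 < \<delta>" "\<delta>' = \<delta> powr \<alpha>" using \<delta>' \<alpha> by (auto simp: \<delta>_def powr_powr)
    have "\<delta> \<le> (\<delta>2 powr \<alpha>) powr (1 / \<alpha>)"
      unfolding \<delta>_def using \<delta>' \<alpha> by (intro powr_mono2) auto
    also have "\<dots> = \<delta>2" using \<alpha> \<delta>2 by (simp add: powr_powr)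
    finally have "\<delta> \<le> \<delta>2" .
    then have "\<delta> \<le> \<delta>E" and \<delta>k0: "2 * \<delta> \<le> (1/2) ^ k0" by (auto simp: \<delta>2_def)
    have "(1/2 :: real) ^ k0 \<le> 1" by (simp add: power_le_one)
    then have \<delta>1: "\<delta> \<le> 1" using \<delta>k0 \<delta> by linarith
    have \<delta>'1: "\<delta>' \<le> 1" using \<delta> \<delta>1 \<alpha> by (simp add: powr_le1)
    obtain I A where cov: "theta_cover \<theta> \<delta> E I A"
      and summ: "(\<lambda>i. diameter (A i) powr s) summable_on I"
      and sum1: "(\<Sum>\<^sub>\<infinity>i\<in>I. diameter (A i) powr s) < 1"
      using \<delta>E(2)[OF \<delta>(1) \<open>\<delta> \<le> \<delta>E\<close>] by blast
    have I: "finite I"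
      using finite_theta_cover[OF \<delta>(1) _ cov summ] s by simp
    define d where "d i = diameter (A i)" for i
    have d: "bounded (A i)" "\<delta> powr (1 / \<theta>) \<le> d i" "d i \<le> \<delta>" "0 < d i" if "i \<in> I" for i
    proof -
      show *: "bounded (A i)" "\<delta> powr (1 / \<theta>) \<le> d i" "d i \<le> \<delta>"
        using cov that by (auto simp: theta_cover_def d_def)
      have "0 < \<delta> powr (1 / \<theta>)" using \<delta> by simp
      with *(2) show "0 < d i" by linarith
    qed
    have sumd: "(\<Sum>i\<in>I. d i powr s) \<le> 1"
      using sum1 I by (simp add: d_def)
    have "\<exists>k. d i \<le> (1/2) ^ k \<and> (1/2) ^ k < 2 * d i" if "i \<in> I" for i
      using obtain_dyadic_scale[of "d i"] d[OF that] \<delta>1 by (metis order_trans)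
    then obtain lev where lev: "\<And>i. i \<in> I \<Longrightarrow> d i \<le> (1/2) ^ lev i"
        "\<And>i. i \<in> I \<Longrightarrow> (1/2) ^ lev i < 2 * d i"
      by metis
    have level_ge: "k0 \<le> k" if "(1/2 :: real) ^ k \<le> 2 * \<delta>" for k
    proof -
      have "(1/2 :: real) ^ k \<le> (1/2) ^ k0" using that \<delta>k0 by linarith
      then show ?thesis by (simp add: power_decreasing_iff)
    qed
    have lev_le: "(1/2) ^ lev i \<le> 2 * \<delta>" if "i \<in> I" for i
      using lev(2)[OF that] d(3)[OF that] by linarith
    \<comment> \<open>\<open>D\<close> serves as a radius, and the ball has twice that
      diameter.\<close>
    define r where "r = \<delta>' / 2"
    have r: "0 < r" using \<delta>' by (simp add: r_def)
    define G where "G i = Pair (lev i) ` dyadic (lev i) ` (E \<inter> A i)" for i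
    have cardG: "card (G i) \<le> 3 ^ DIM('a)" if i: "i \<in> I" for i
    proof (cases "E \<inter> A i = {}")
      case False
      then obtain x where x: "x \<in> E" "x \<in> A i" by blast
      have sub: "dyadic (lev i) ` (E \<inter> A i) \<subseteq> near (dyadic (lev i) x)"
      proof (rule image_subsetI)
        fix y assume y: "y \<in> E \<inter> A i"
        have "dist x y \<le> d i"
          unfolding d_def using diameter_bounded_bound[OF d(1)[OF i]] x y by simp
        then show "dyadic (lev i) y \<in> near (dyadic (lev i) x)"
          using lev(1)[OF i] by (intro dyadic_near) linarith
      qed
      have "card (dyadic (lev i) ` (E \<inter> A i)) \<le> 3 ^ DIM('a)"
        using card_mono[OF finite_near sub] by (simp only: card_near)
      then show ?thesis
        by (simp add: G_def card_image inj_on_def)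
    qed (simp add: G_def)
    have G: "G i \<subseteq> {lev i} \<times> dyadic (lev i) ` E" for i
      by (auto simp: G_def)
    have finG: "finite (G i)" for i
      by (rule finite_subset[OF G]) (simp add: finite_dyadic_image[OF E])
    define U where "U = (\<Union>i\<in>I. G i)"
    have finU: "finite U" using I finG by (simp add: U_def)
    define P1 where "P1 = {q \<in> U. D (fst q) (snd q) \<le> r}"
    define L where "L = {k. (1/2) ^ k \<le> 2 * \<delta> \<and> bad r k \<noteq> {}}"
    define H where "H k z = Pair (Suc k) ` {z' \<in> dyadic (Suc k) ` E. z' \<in> near (\<lambda>i. 2 * z i) \<and> D (Suc k) z' \<le> r}" for k z
    define P2 where "P2 = (\<Union>k\<in>L. \<Union>z\<in>bad r k. H k z)"
    obtain B where B: "\<And>k z. B \<le> k \<Longrightarrow> k0 \<le> k \<Longrightarrow> z \<in> dyadic k ` E \<Longrightarrow> D k z \<le> r"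
      using eventually_not_bad[OF r] by blast
    have finL: "finite L"
    proof (rule finite_subset)
      show "L \<subseteq> {..<B}"
      proof
        fix k assume "k \<in> L"
        then obtain z where "k0 \<le> k" "z \<in> dyadic k ` E" "r < D k z"
          using level_ge by (auto simp: L_def bad_def)
        then show "k \<in> {..<B}" using B[of k z] by (meson lessThan_iff not_le)
      qed
    qed simp
    have finH: "finite (H k z)" and cardH: "card (H k z) \<le> 3 ^ DIM('a)" for k z
    proof -
      let ?S = "{z' \<in> dyadic (Suc k) ` E. z' \<in> near (\<lambda>i. 2 * z i) \<and> D (Suc k) z' \<le> r}"
      have sub: "?S \<subseteq> near (\<lambda>i. 2 * z i)" by auto
      then show "finite (H k z)"
        using finite_subset[OF sub finite_near] by (simp add: H_def)
      have "card ?S \<le> 3 ^ DIM('a)"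
        using card_mono[OF finite_near sub] by (simp only: card_near)
      then show "card (H k z) \<le> 3 ^ DIM('a)"
        by (simp add: H_def card_image inj_on_def)
    qed
    have finP: "finite P1" "finite P2"
      using finU finL finite_bad finH by (auto simp: P1_def P2_def)
    have P: "k0 \<le> fst q" "snd q \<in> dyadic (fst q) ` E" "D (fst q) (snd q) \<le> r" if "q \<in> P1 \<union> P2" for q
    proof -
      have "k0 \<le> fst q \<and> snd q \<in> dyadic (fst q) ` E \<and> D (fst q) (snd q) \<le> r"
        using that
      proof
        assume "q \<in> P1"
        then obtain i where "i \<in> I" "q \<in> G i" "D (fst q) (snd q) \<le> r" by (auto simp: P1_def U_def)
        then show ?thesis using G[of i] level_ge[OF lev_le] by auto
      next
        assume "q \<in> P2"
        then obtain k z where "k \<in> L" "q \<in> H k z" by (auto simp: P2_def)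
        then show ?thesis using level_ge by (auto simp: H_def L_def le_SucI)
      qed
      then show "k0 \<le> fst q" "snd q \<in> dyadic (fst q) ` E" "D (fst q) (snd q) \<le> r" by auto
    qed
    define rep where "rep q = (SOME x. x \<in> E \<and> dyadic (fst q) x = snd q)" for q
    have rep: "rep q \<in> E" "dyadic (fst q) (rep q) = snd q" if "q \<in> P1 \<union> P2" for q
    proof -
      have "\<exists>x. x \<in> E \<and> dyadic (fst q) x = snd q"
        using P(2)[OF that] by (auto simp: image_iff)
      from someI_ex[OF this] show "rep q \<in> E" "dyadic (fst q) (rep q) = snd q"
        unfolding rep_def by blast+
    qed
    define m where "m = \<delta>' powr (1 / \<theta>)"
    have m: "0 < m" "m \<le> \<delta>'"
    proof -
      show "0 < m" using \<delta>' by (simp add: m_def)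
      have "\<delta>' powr (1 / \<theta>) \<le> \<delta>' powr 1"
        using \<delta>' \<delta>'1 \<theta> by (intro powr_mono') auto
      then show "m \<le> \<delta>'" using \<delta>' by (simp add: m_def)
    qed
    \<comment> \<open>The maximum enlarges balls that would fall below the minimal diameter
      \<open>m\<close>.\<close>
    define \<rho> where "\<rho> q = max (D (fst q) (snd q)) (m / 2)" for q
    have "f ` E \<subseteq> (\<Union>q\<in>P1 \<union> P2. cball (f (rep q)) (\<rho> q))"
    proof (rule image_subsetI)
      fix y assume y: "y \<in> E"
      then obtain i where i: "i \<in> I" "y \<in> A i"
        using cov by (auto simp: theta_cover_def)
      have "\<exists>k. (k, dyadic k y) \<in> P1 \<union> P2"
      proof (cases "D (lev i) (dyadic (lev i) y) \<le> r")
        case True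
        then have "(lev i, dyadic (lev i) y) \<in> P1"
          using i y by (auto simp: P1_def U_def G_def)
        then show ?thesis by blast
      next
        case False
        let ?Q = "\<lambda>k. lev i \<le> k \<and> D k (dyadic k y) \<le> r"
        have ex: "?Q (max (lev i) B)"
          using B[of "max (lev i) B" "dyadic (max (lev i) B) y"] y level_ge[OF lev_le[OF i(1)]] by auto
        \<comment> \<open>A stopping argument: at the first level where the cell of \<open>y\<close>
          fits, its parent is bad, so the cell belongs to \<open>P2\<close>.\<close>
        define j where "j = (LEAST k. ?Q k)"
        have j: "?Q j" unfolding j_def by (rule LeastI[of ?Q, OF ex])
        with False have "lev i \<noteq> j" by auto
        with j obtain k where k: "j = Suc k" "lev i \<le> k" by (cases j) auto
        have "\<not> ?Q k" using not_less_Least[of k ?Q] k by (simp add: j_def)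
        then have "r < D k (dyadic k y)" using k by simp
        then have kb: "dyadic k y \<in> bad r k" using y by (simp add: bad_def)
        have "(1/2 :: real) ^ k \<le> (1/2) ^ lev i" using k by (intro power_decreasing) auto
        then have "(1/2) ^ k \<le> 2 * \<delta>" using lev_le[OF i(1)] by linarith
        then have "k \<in> L" using kb by (auto simp: L_def)
        moreover have "(Suc k, dyadic (Suc k) y) \<in> H k (dyadic k y)"
          using j k y dyadic_Suc_near[of k y] by (auto simp: H_def)
        ultimately show ?thesis using kb by (auto simp: P2_def)
      qed
      then obtain k where k: "(k, dyadic k y) \<in> P1 \<union> P2" by blast
      let ?q = "(k, dyadic k y)"
      have "dist (f (rep ?q)) (f y) \<le> D k (dyadic k y)"
        using dist_le[of k "rep ?q" y] P[OF k] rep[OF k] y by (simp add: D_def \<gamma>_def)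
      then have "f y \<in> cball (f (rep ?q)) (\<rho> ?q)" by (simp add: \<rho>_def)
      then show "f y \<in> (\<Union>q\<in>P1 \<union> P2. cball (f (rep q)) (\<rho> q))" using k by blast
    qed
    moreover have \<rho>_bounds: "\<forall>q\<in>P1 \<union> P2. \<delta>' powr (1 / \<theta>) \<le> 2 * \<rho> q \<and> 2 * \<rho> q \<le> \<delta>'"
    proof
      fix q assume "q \<in> P1 \<union> P2"
      from P(3)[OF this] m(2) show "\<delta>' powr (1 / \<theta>) \<le> 2 * \<rho> q \<and> 2 * \<rho> q \<le> \<delta>'"
        unfolding m_def[symmetric] \<rho>_def r_def by linarith
    qed
    moreover have "(\<Sum>q\<in>P1 \<union> P2. (2 * \<rho> q) powr t') \<le> (K1 + 3 ^ DIM('a) + K2) * \<delta>' powr (\<gamma> * \<eta> / \<alpha>)"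
    proof -
      have \<delta>pow: "\<delta>' powr (\<gamma> * \<eta> / \<alpha>) = \<delta> powr (\<gamma> * \<eta>)"
        using \<alpha> by (simp add: \<delta>(2) powr_powr)
      have t'0: "0 < t'" using t0 \<eta> by simp
      have "(\<Sum>q\<in>P1. (2 * \<rho> q) powr t') \<le> (\<Sum>q\<in>U. (2 * \<rho> q) powr t')"
        using finU by (intro sum_mono2) (auto simp: P1_def)
      also have "\<dots> \<le> (\<Sum>q\<in>U. (2 * D (fst q) (snd q)) powr t' + m powr t')"
        by (intro sum_mono) (auto simp: \<rho>_def max_def)
      also have "\<dots> = (\<Sum>q\<in>U. (2 * D (fst q) (snd q)) powr t') + (\<Sum>q\<in>U. m powr t')"
        by (rule sum.distrib)
      also have "(\<Sum>q\<in>U. (2 * D (fst q) (snd q)) powr t') \<le> K1 * \<delta> powr (\<gamma> * \<eta>)"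
      proof -
        have "(\<Sum>(k, z)\<in>U. (2 * D k z) powr (t + \<eta>)) \<le> (2 * C) powr t * (2 * C * M powr (1 / p)) powr \<eta> *
            (3 ^ DIM('a) * 2 powr s + M / (1 - (1/2) powr (\<gamma> * \<eta>))) * (2 * \<delta>) powr (\<gamma> * \<eta>)"
          unfolding U_def
          by (rule sum_D_powr_le[where lev = lev and d = d])
            (use s \<eta> I lev d sumd G cardG level_ge[OF lev_le] in \<open>auto simp: t_def n_def less_imp_le\<close>)
        also have "(2 * \<delta>) powr (\<gamma> * \<eta>) = 2 powr (\<gamma> * \<eta>) * \<delta> powr (\<gamma> * \<eta>)"
          by (rule powr_mult)
        finally show ?thesis by (simp add: K1_def \<eta>(2) case_prod_unfold mult.assoc)
      qed
      \<comment> \<open>The lower bound on the given cover pays for the enlarged balls: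
        \<open>m powr t\<close> equals \<open>(\<delta> powr (1 / \<theta>)) powr s\<close>, which
        is at most \<open>d i powr s\<close>.\<close>
      also have "(\<Sum>q\<in>U. m powr t') \<le> 3 ^ DIM('a) * \<delta> powr (\<gamma> * \<eta>)"
      proof -
        have "(\<Sum>q\<in>U. m powr t') \<le> (\<Sum>i\<in>I. \<Sum>q\<in>G i. m powr t')"
          unfolding U_def by (rule sum_UN_le[OF I finG]) simp
        also have "\<dots> \<le> (\<Sum>i\<in>I. 3 ^ DIM('a) * (d i powr s * \<delta> powr (\<gamma> * \<eta>)))"
        proof (rule sum_mono)
          fix i assume i: "i \<in> I"
          have "\<alpha> * t' / \<theta> = s / \<theta> + \<alpha> * \<eta> / \<theta>"
            using \<alpha>(2) by (simp add: \<eta>(2) distrib_left add_divide_distrib)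
          then have "m powr t' = (\<delta> powr (1 / \<theta>)) powr s * \<delta> powr (\<alpha> * \<eta> / \<theta>)"
            by (simp add: m_def \<delta>(2) powr_powr powr_add[symmetric])
          also have "\<dots> \<le> d i powr s * \<delta> powr (\<gamma> * \<eta>)"
          proof (intro mult_mono powr_mono2 powr_mono')
            have "\<gamma> * \<eta> * \<theta> \<le> \<alpha> * \<eta> * 1"
              using \<gamma> \<gamma>\<alpha> \<eta> \<theta> \<alpha> by (intro mult_mono) auto
            then show "\<gamma> * \<eta> \<le> \<alpha> * \<eta> / \<theta>" using \<theta> by (simp add: pos_le_divide_eq)
          qed (use d[OF i] s \<delta> \<delta>1 in auto)
          finally have "m powr t' \<le> d i powr s * \<delta> powr (\<gamma> * \<eta>)" .
          then have "real (card (G i)) * m powr t' \<le> real (3 ^ DIM('a)) * (d i powr s * \<delta> powr (\<gamma> * \<eta>))"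
            using cardG[OF i] by (intro mult_mono of_nat_mono) auto
          then show "(\<Sum>q\<in>G i. m powr t') \<le> 3 ^ DIM('a) * (d i powr s * \<delta> powr (\<gamma> * \<eta>))" by simp
        qed
        also have "\<dots> = 3 ^ DIM('a) * \<delta> powr (\<gamma> * \<eta>) * (\<Sum>i\<in>I. d i powr s)"
          by (simp add: sum_distrib_left sum_distrib_right mult_ac)
        also have "\<dots> \<le> 3 ^ DIM('a) * \<delta> powr (\<gamma> * \<eta>) * 1"
          using sumd by (intro mult_left_mono) auto
        finally show ?thesis by simp
      qed
      finally have S1: "(\<Sum>q\<in>P1. (2 * \<rho> q) powr t') \<le> (K1 + 3 ^ DIM('a)) * \<delta> powr (\<gamma> * \<eta>)"
        by (simp add: distrib_right)
      \<comment> \<open>Every ball of \<open>P2\<close> is charged the full scale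
        \<open>\<delta>'\<close>, whatever its level; only the number of balls is estimated.\<close>
      have "(\<Sum>q\<in>P2. (2 * \<rho> q) powr t') \<le> (\<Sum>q\<in>P2. \<delta>' powr t')"
      proof (intro sum_mono powr_mono2)
        fix q assume "q \<in> P2"
        then show "2 * \<rho> q \<le> \<delta>'" using \<rho>_bounds by blast
      qed (use t'0 m D_nonneg in \<open>auto simp: \<rho>_def le_max_iff_disj\<close>)
      also have "\<dots> \<le> (\<Sum>k\<in>L. \<Sum>q\<in>(\<Union>z\<in>bad r k. H k z). \<delta>' powr t')"
        unfolding P2_def by (rule sum_UN_le) (use finL finite_bad finH in auto)
      also have "\<dots> \<le> (\<Sum>k\<in>L. \<Sum>z\<in>bad r k. \<Sum>q\<in>H k z. \<delta>' powr t')"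
        by (intro sum_mono sum_UN_le) (use finite_bad finH in auto)
      also have "\<dots> \<le> (\<Sum>k\<in>L. \<Sum>z\<in>bad r k. real (3 ^ DIM('a)) * \<delta>' powr t')"
      proof (intro sum_mono)
        fix k z
        have "real (card (H k z)) \<le> real (3 ^ DIM('a))" using cardH by (intro of_nat_mono)
        then show "(\<Sum>q\<in>H k z. \<delta>' powr t') \<le> real (3 ^ DIM('a)) * \<delta>' powr t'"
          by (simp add: mult_right_mono)
      qed
      also have "\<dots> = 3 ^ DIM('a) * \<delta>' powr t' * (\<Sum>k\<in>L. real (card (bad r k)))"
        by (simp add: sum_distrib_left sum_distrib_right mult_ac)
      also have "\<dots> \<le> 3 ^ DIM('a) * \<delta>' powr t' * (\<Sum>k\<in>L. (C / r) powr p * M * ((1/2) ^ k) powr (p - n))"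
        unfolding n_def using r level_ge by (intro mult_left_mono sum_mono card_bad_le) (auto simp: L_def)
      also have "\<dots> = 3 ^ DIM('a) * \<delta>' powr t' * ((C / r) powr p * M * (\<Sum>k\<in>L. ((1/2) ^ k) powr (p - n)))"
        by (simp add: sum_distrib_left)
      also have "\<dots> \<le> 3 ^ DIM('a) * \<delta>' powr t' * ((C / r) powr p * M * ((2 * \<delta>) powr (p - n) / (1 - (1/2) powr (p - n))))"
      proof -
        have "(\<Sum>k\<in>L. ((1/2) ^ k) powr (p - n)) \<le> (2 * \<delta>) powr (p - n) / (1 - (1/2) powr (p - n))"
        proof (rule sum_halves_powr_le[OF finL])
          show "(1/2) ^ k \<le> 2 * \<delta>" if "k \<in> L" for k using that unfolding L_def by blast
          show "0 < p - n" using p by (simp add: n_def)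
        qed
        then show ?thesis using M by (intro mult_left_mono mult_nonneg_nonneg) simp_all
      qed
      also have "\<dots> = K2 * (\<delta>' powr t' * \<delta>' powr (- p) * \<delta> powr (p - n))"
      proof -
        have "C / r = (2 * C) / \<delta>'" by (simp add: r_def)
        then have "(C / r) powr p = (2 * C) powr p / \<delta>' powr p" by (simp only: powr_divide)
        then have "(C / r) powr p = (2 * C) powr p * \<delta>' powr (- p)" by (simp only: powr_minus divide_inverse)
        moreover have "(2 * \<delta>) powr (p - n) = 2 powr (p - n) * \<delta> powr (p - n)" by (rule powr_mult)
        ultimately show ?thesis
          unfolding K2_def by (simp only: mult_ac times_divide_eq_left times_divide_eq_right)
      qed
      also have "\<delta>' powr t' * \<delta>' powr (- p) * \<delta> powr (p - n) = \<delta> powr (\<alpha> * t' - \<alpha> * p + (p - n))"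
        by (simp add: \<delta>(2) powr_powr powr_add[symmetric])
      \<comment> \<open>Since \<open>\<alpha> * p = p - n + s\<close> and
        \<open>\<alpha> * t = s\<close>, the number of bad cells and the cost per child cancel up to
        the excess.\<close>
      also have "\<alpha> * t' - \<alpha> * p + (p - n) = \<alpha> * \<eta>"
        using \<alpha> by (simp add: \<eta>(2) distrib_left)
      also have "K2 * \<delta> powr (\<alpha> * \<eta>) \<le> K2 * \<delta> powr (\<gamma> * \<eta>)"
        using K \<gamma>\<alpha> \<eta> \<delta> \<delta>1 by (intro mult_left_mono powr_mono') auto
      finally have S2: "(\<Sum>q\<in>P2. (2 * \<rho> q) powr t') \<le> K2 * \<delta> powr (\<gamma> * \<eta>)" .
      have "(\<Sum>q\<in>P1 \<union> P2. (2 * \<rho> q) powr t') + (\<Sum>q\<in>P1 \<inter> P2. (2 * \<rho> q) powr t')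
          = (\<Sum>q\<in>P1. (2 * \<rho> q) powr t') + (\<Sum>q\<in>P2. (2 * \<rho> q) powr t')"
        by (rule sum.union_inter[OF finP])
      moreover have "0 \<le> (\<Sum>q\<in>P1 \<inter> P2. (2 * \<rho> q) powr t')" by (intro sum_nonneg) auto
      ultimately show ?thesis
        using S1 S2 unfolding \<delta>pow by (simp add: distrib_right)
    qed
    ultimately show "\<exists>(P :: (nat \<times> ('a \<Rightarrow> int)) set) c \<rho>. finite P \<and> f ` E \<subseteq> (\<Union>q\<in>P. cball (c q) (\<rho> q)) \<and>
        (\<forall>q\<in>P. \<delta>' powr (1 / \<theta>) \<le> 2 * \<rho> q \<and> 2 * \<rho> q \<le> \<delta>') \<and>
        (\<Sum>q\<in>P. (2 * \<rho> q) powr t') \<le> (K1 + 3 ^ DIM('a) + K2) * \<delta>' powr (\<gamma> * \<eta> / \<alpha>)"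
      using finP by (intro exI[of _ "P1 \<union> P2"] exI[of _ "\<lambda>q. f (rep q)"] exI[of _ \<rho>]) simp
  qed (use \<gamma>\<eta> \<alpha>(1) Kpos \<delta>2 in simp_all)
qed

text \<open>Ensures that the infimum for \<open>E\<close> is over a nonempty set. One level of cells
  suffices, and their number is bounded because by \<open>ge\<close> each carries at least its
  volume in energy.\<close>

lemma admissible_domain:
  assumes \<theta>: "0 < \<theta>" "\<theta> < 1"
  shows "admissible \<theta> E (real DIM('a) + 1)"
proof -
  let ?n = "real DIM('a)"
  have n: "1 \<le> ?n" by (simp add: Suc_leI)
  define \<tau> where "\<tau> = min 1 ((1/2 :: real) ^ k0)"
  show ?thesis
  proof (rule admissible_of_ball_covers[where \<kappa> = 1 and K = "M * (4 * ?n) powr ?n" and \<tau> = \<tau>])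
    fix \<delta> :: real assume \<delta>: "0 < \<delta>" "\<delta> \<le> \<tau>"
    then have \<delta>1: "\<delta> \<le> 1" and \<delta>k0: "\<delta> \<le> (1/2) ^ k0" by (auto simp: \<tau>_def)
    \<comment> \<open>Cells of side below \<open>2 * d\<close> have diameter at most
      \<open>2 * d\<close> times the dimension, which is the radius
      \<open>\<delta> / 2\<close>.\<close>
    define d where "d = \<delta> / (4 * ?n)"
    have d0: "0 < d" using \<delta> n by (simp add: d_def)
    moreover have "d * 1 \<le> d * ?n" using d0 n by (intro mult_left_mono) auto
    moreover have "4 * (d * ?n) = \<delta>" using n by (simp add: d_def)
    ultimately have d: "0 < d" "d \<le> \<delta>" "2 * d \<le> \<delta>" by linarith+
    then have "d \<le> 1" using \<delta>1 by linarith
    then obtain k where k: "d \<le> (1/2) ^ k" "(1/2) ^ k < 2 * d"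
      using obtain_dyadic_scale[OF d(1)] by blast
    have "(1/2 :: real) ^ k \<le> (1/2) ^ k0" using k d \<delta>k0 by linarith
    then have k0: "k0 \<le> k" by (simp add: power_decreasing_iff)
    define P where "P = dyadic k ` E"
    define rep where "rep z = (SOME x. x \<in> E \<and> dyadic k x = z)" for z
    have rep: "rep z \<in> E" "dyadic k (rep z) = z" if "z \<in> P" for z
    proof -
      have "\<exists>x. x \<in> E \<and> dyadic k x = z" using that by (auto simp: P_def)
      from someI_ex[OF this] show "rep z \<in> E" "dyadic k (rep z) = z" unfolding rep_def by blast+
    qed
    have finP: "finite P" by (simp add: P_def finite_dyadic_image[OF E])
    have "E \<subseteq> (\<Union>z\<in>P. cball (rep z) (\<delta> / 2))"
    proof
      fix x assume x: "x \<in> E"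
      then have xP: "dyadic k x \<in> P" by (simp add: P_def)
      have "dist (rep (dyadic k x)) x \<le> ?n * (1/2) ^ k"
        using dist_le_dyadic_cube self_mem_dyadic_cube[of "rep (dyadic k x)" k] self_mem_dyadic_cube[of x k]
          rep(2)[OF xP] by metis
      also have "\<dots> \<le> ?n * (2 * d)" using k n by (intro mult_left_mono) auto
      also have "\<dots> = \<delta> / 2" using n by (simp add: d_def)
      finally show "x \<in> (\<Union>z\<in>P. cball (rep z) (\<delta> / 2))" using xP by auto
    qed
    moreover have "\<delta> powr (1 / \<theta>) \<le> \<delta> powr 1"
      using \<delta> \<delta>1 \<theta> by (intro powr_mono') auto
    moreover have "(\<Sum>z\<in>P. (2 * (\<delta> / 2)) powr (?n + 1)) \<le> M * (4 * ?n) powr ?n * \<delta> powr 1"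
    proof -
      have "real (card P) * d powr ?n = (\<Sum>z\<in>P. d powr ?n)" by simp
      also have "\<dots> \<le> (\<Sum>z\<in>P. a k z)"
      proof (rule sum_mono)
        fix z assume z: "z \<in> P"
        have "d powr ?n \<le> ((1/2) ^ k) ^ DIM('a)"
          using k d by (simp add: powr_realpow power_mono)
        also have "\<dots> \<le> a k z" using ge[OF k0] z by (simp add: P_def)
        finally show "d powr ?n \<le> a k z" .
      qed
      also have "\<dots> \<le> M" using sum_le[OF k0] by (simp add: P_def)
      finally have le: "real (card P) * d powr ?n \<le> M" .
      have "\<delta> = d * (4 * ?n)" using n by (simp add: d_def)
      then have "\<delta> powr ?n = d powr ?n * (4 * ?n) powr ?n" by (simp only: powr_mult)
      then have "(\<Sum>z\<in>P. (2 * (\<delta> / 2)) powr (?n + 1)) = (real (card P) * d powr ?n) * ((4 * ?n) powr ?n * \<delta> powr 1)"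
        by (simp add: powr_add)
      also have "\<dots> \<le> M * ((4 * ?n) powr ?n * \<delta> powr 1)"
        using le by (intro mult_right_mono) auto
      finally show ?thesis by (simp only: mult.assoc)
    qed
    ultimately show "\<exists>(P :: ('a \<Rightarrow> int) set) c \<rho>. finite P \<and> E \<subseteq> (\<Union>q\<in>P. cball (c q) (\<rho> q)) \<and>
        (\<forall>q\<in>P. \<delta> powr (1 / \<theta>) \<le> 2 * \<rho> q \<and> 2 * \<rho> q \<le> \<delta>) \<and>
        (\<Sum>q\<in>P. (2 * \<rho> q) powr (?n + 1)) \<le> M * (4 * ?n) powr ?n * \<delta> powr 1"
      using finP \<delta> by (intro exI[of _ P] exI[of _ rep] exI[of _ "\<lambda>_. \<delta> / 2"]) simp
  qed (use M n in \<open>auto simp: \<tau>_def\<close>)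
qed

text \<open>Instead of passing to the limit in \<open>s\<close>, the bound for each \<open>s\<close>
  is solved for \<open>s\<close>. This gives a lower bound for all admissible \<open>s\<close>,
  hence for their infimum, and solving back gives the claim.\<close>

lemma upper_intermediate_dim_image_le:
  assumes \<theta>: "0 < \<theta>" "\<theta> < 1"
  shows "upper_intermediate_dim \<theta> (f ` E) \<le>
    p * upper_intermediate_dim \<theta> E / (p - real DIM('a) + upper_intermediate_dim \<theta> E)"
proof -
  define n where "n = real DIM('a)"
  define S where "S = {s. s > 0 \<and> admissible \<theta> E s}"
  define L where "L = upper_intermediate_dim \<theta> (f ` E)"
  have pn: "0 < p - n" using p by (simp add: n_def)
  have S: "S \<noteq> {}" using admissible_domain[OF \<theta>] by (auto simp: S_def intro!: exI[of _ "real DIM('a) + 1"])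
  have d: "upper_intermediate_dim \<theta> E = Inf S" by (simp add: upper_intermediate_dim_eq S_def)
  have d0: "0 \<le> Inf S" using S by (intro cInf_greatest) (auto simp: S_def)
  have L_le: "L \<le> p * s / (p - n + s)" if "s \<in> S" for s
  \<comment> \<open>Admissibility for the image is known only strictly above the critical
    value.\<close>
  proof (rule dense_ge)
    fix t' assume t': "p * s / (p - n + s) < t'"
    have s: "0 < s" "admissible \<theta> E s" using that by (auto simp: S_def)
    have "admissible \<theta> (f ` E) t'"
      using admissible_image[OF \<theta> s] t' by (simp add: n_def)
    moreover have "0 < p * s / (p - n + s)" using s pn p_pos by simp
    ultimately show "L \<le> t'"
      unfolding L_def upper_intermediate_dim_eq using t'
      by (intro cInf_lower) (auto intro: bdd_belowI[of _ 0])
  qed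
  obtain s0 where s0: "s0 \<in> S" using S by blast
  \<comment> \<open>The strict inequality \<open>L < p\<close> permits the division by
    \<open>p - L\<close> below.\<close>
  have "p * s0 / (p - n + s0) < p"
    using s0 pn p_pos by (simp add: S_def field_simps)
  with L_le[OF s0] have Lp: "L < p" by linarith
  have "L * (p - n) / (p - L) \<le> s" if "s \<in> S" for s
  proof -
    have "0 < p - n + s" using that pn by (simp add: S_def)
    then have "L * (p - n + s) \<le> p * s"
      using L_le[OF that] by (simp add: pos_le_divide_eq)
    then show ?thesis using Lp by (simp add: pos_divide_le_eq algebra_simps)
  qed
  then have "L * (p - n) / (p - L) \<le> Inf S" using S by (intro cInf_greatest) auto
  then have "L * (p - n) \<le> Inf S * (p - L)" using Lp by (simp add: pos_divide_le_eq)
  then have "L * (p - n + Inf S) \<le> p * Inf S" by (simp add: algebra_simps)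
  then show ?thesis
    using d0 pn unfolding d L_def[symmetric] n_def[symmetric] by (simp add: pos_le_divide_eq)
qed

end

subsection \<open>Sobolev maps\<close>

text \<open>Morrey's inequality for each component; adding the components through the l1 norm costs
  the factor \<open>real CARD('m)\<close>.\<close>

lemma sobolev_dyadic_cube_bound:
  fixes f :: "'a::euclidean_space \<Rightarrow> real ^ 'm"
  assumes \<Omega>: "open \<Omega>" "dyadic_cube k z \<subseteq> \<Omega>" and f: "continuous_on \<Omega> f" and p: "real DIM('a) < p"
    and g: "\<And>j i. i \<in> Basis \<Longrightarrow> g j i \<in> Lp_on p \<Omega>"
      "\<And>j i. i \<in> Basis \<Longrightarrow> weak_derivative \<Omega> i (\<lambda>x. f x $ j) (g j i)"
    and A: "0 < A" "\<And>j i. i \<in> Basis \<Longrightarrow> (LINT y:dyadic_cube k z|lebesgue. \<bar>g j i y\<bar> powr p) \<le> A"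
    and xy: "x \<in> dyadic_cube k z" "y \<in> dyadic_cube k z"
  shows "dist (f x) (f y) \<le> real CARD('m) * morrey_const TYPE('a) p
    * ((1/2) ^ k) powr (1 - real DIM('a) / p) * A powr (1 / p)"
proof -
  define c :: 'a where "c = (\<Sum>i\<in>Basis. (z i * (1/2) ^ k) *\<^sub>R i)"
  have Q: "dyadic_cube k z = cbox c (c + (1/2) ^ k *\<^sub>R One)"
    by (simp add: dyadic_cube_def Let_def c_def)
  have "\<bar>(f x - f y) $ j\<bar> \<le> morrey_const TYPE('a) p * ((1/2) ^ k) powr (1 - real DIM('a) / p) * A powr (1 / p)" for j
  proof -
    have "continuous_on (cbox c (c + (1/2) ^ k *\<^sub>R One)) (\<lambda>x. f x $ j)"
      using f \<Omega>(2) unfolding Q by (intro continuous_intros) (rule continuous_on_subset)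
    then have "\<bar>f x $ j - f y $ j\<bar> \<le> morrey_const TYPE('a) p * ((1/2) ^ k) powr (1 - real DIM('a) / p) * A powr (1 / p)"
      by (rule morrey_cube[rotated, where g = "g j"])
        (use \<Omega> p g A xy in \<open>auto simp: Q\<close>)
    then show ?thesis by simp
  qed
  then have "(\<Sum>j\<in>UNIV. \<bar>(f x - f y) $ j\<bar>) \<le>
      (\<Sum>j\<in>(UNIV::'m set). morrey_const TYPE('a) p * ((1/2) ^ k) powr (1 - real DIM('a) / p) * A powr (1 / p))"
    by (intro sum_mono)
  then show ?thesis
    using norm_le_l1_cart[of "f x - f y"] by (simp add: dist_norm mult.assoc)
qed

text \<open>The energy of a cube is the integral of \<open>h\<close> over it. Morrey's inequality
  gives \<open>dist_le\<close>, bounded overlap gives \<open>sum_le\<close>, and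
  \<open>1 \<le> h\<close> gives \<open>ge\<close>.\<close>

lemma sobolev_dyadic_energy:
  fixes f :: "'a::euclidean_space \<Rightarrow> real ^ 'm"
  assumes \<Omega>: "open \<Omega>" and p: "real DIM('a) < p" and f: "f \<in> sobolev_W1_map p \<Omega>" "continuous_on \<Omega> f"
    and E: "compact E" "E \<subseteq> \<Omega>"
  shows "\<exists>a C M k0. dyadic_energy E f a p C M k0"
proof -
  have "\<exists>g. \<forall>j. \<forall>i\<in>Basis. g j i \<in> Lp_on p \<Omega> \<and> weak_derivative \<Omega> i (\<lambda>x. f x $ j) (g j i)"
    using f(1) unfolding sobolev_W1_map_def sobolev_W1_def by (intro choice allI bchoice) auto
  then obtain g where g: "\<And>j i. i \<in> Basis \<Longrightarrow> g j i \<in> Lp_on p \<Omega>"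
      "\<And>j i. i \<in> Basis \<Longrightarrow> weak_derivative \<Omega> i (\<lambda>x. f x $ j) (g j i)"
    by blast
  obtain e where e: "0 < e" "(\<Union>x\<in>E. ball x e) \<subseteq> \<Omega>"
    using compact_subset_open_imp_ball_epsilon_subset[OF E(1) \<Omega> E(2)] by blast
  \<comment> \<open>The domain may have infinite measure, on which the constant 1 in
    \<open>h\<close> is not integrable; a bounded neighbourhood of \<open>E\<close> avoids
    this.\<close>
  define K where "K = (\<Union>x\<in>E. ball x e)"
  have KO: "K \<subseteq> \<Omega>" using e by (simp add: K_def)
  have Kl: "K \<in> lmeasurable"
  proof (rule lmeasurable_open)
    obtain R where R: "\<And>x. x \<in> E \<Longrightarrow> norm x \<le> R"
      using compact_imp_bounded[OF E(1)] by (auto simp: bounded_iff)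
    show "bounded K"
    proof (rule boundedI)
      fix y assume "y \<in> K"
      then obtain x where "x \<in> E" "dist x y < e" by (auto simp: K_def)
      then show "norm y \<le> R + e"
        using R[of x] norm_triangle_sub[of y x] by (simp add: dist_norm norm_minus_commute)
    qed
    show "open K" by (auto simp: K_def)
  qed
  define h where "h y = 1 + (\<Sum>j\<in>UNIV. \<Sum>i\<in>Basis. \<bar>g j i y\<bar> powr p)" for y
  have hpos: "1 \<le> h y" for y by (auto simp: h_def intro!: sum_nonneg)
  have g_le_h: "\<bar>g j i y\<bar> powr p \<le> h y" if "i \<in> Basis" for j i y
  proof -
    have "\<bar>g j i y\<bar> powr p \<le> (\<Sum>i\<in>Basis. \<bar>g j i y\<bar> powr p)"
      using that by (intro member_le_sum) auto
    also have "\<dots> \<le> (\<Sum>j\<in>UNIV. \<Sum>i\<in>Basis. \<bar>g j i y\<bar> powr p)"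
      by (rule member_le_sum) (auto intro: sum_nonneg)
    finally show ?thesis by (simp add: h_def)
  qed
  have gK: "set_integrable lebesgue K (\<lambda>y. \<bar>g j i y\<bar> powr p)" if "i \<in> Basis" for j i
  proof (rule set_integrable_subset[OF _ _ KO])
    show "set_integrable lebesgue \<Omega> (\<lambda>y. \<bar>g j i y\<bar> powr p)"
      using g(1)[OF that] \<Omega> by (simp add: Lp_on_def set_integrable_def integrable_restrict_space)
  qed (use Kl in blast)
  have hK: "set_integrable lebesgue K h"
  proof -
    have "integrable lebesgue (indicat_real K)"
      using Kl by (auto simp: fmeasurable_def intro!: integrable_real_indicator)
    then have "integrable lebesgue (\<lambda>y. indicat_real K y +
        (\<Sum>j\<in>UNIV. \<Sum>i\<in>Basis. indicat_real K y *\<^sub>R (\<bar>g j i y\<bar> powr p)))"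
      by (intro Bochner_Integration.integrable_add Bochner_Integration.integrable_sum
          gK[unfolded set_integrable_def])
    then show ?thesis
      by (simp add: set_integrable_def h_def distrib_left sum_distrib_left)
  qed
  define a where "a k z = (LINT y:dyadic_cube k z|lebesgue. h y)" for k z
  \<comment> \<open>The factor is the overlap of closed cubes of one level; the added 1 makes
    \<open>M\<close> positive even if \<open>K\<close> is empty.\<close>
  define M where "M = 3 ^ DIM('a) * (LINT y:K|lebesgue. h y) + 1"
  define C where "C = real CARD('m) * morrey_const TYPE('a) p"
  have "0 \<le> (LINT y:K|lebesgue. h y)"
    using order_trans[OF zero_le_one hpos] by (simp add: set_lebesgue_integral_def)
  then have M: "0 < M" by (simp add: M_def add_nonneg_pos)
  \<comment> \<open>From this level on, a cube containing a point of \<open>E\<close> has diameter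
    below \<open>e\<close> and so lies in \<open>K\<close>.\<close>
  obtain k0 where k0: "(1/2) ^ k0 < e / real DIM('a)"
    using real_arch_pow_inv[of "e / real DIM('a)" "1/2"] e by auto
  have cubeK: "dyadic_cube k z \<subseteq> K" if "k0 \<le> k" "z \<in> dyadic k ` E" for k z
  proof
    fix y assume y: "y \<in> dyadic_cube k z"
    obtain x where x: "x \<in> E" "z = dyadic k x" using \<open>z \<in> dyadic k ` E\<close> by blast
    have "dist x y \<le> real DIM('a) * (1/2) ^ k"
      using dist_le_dyadic_cube[OF _ y, of x] self_mem_dyadic_cube[of x k] x by simp
    also have "\<dots> \<le> real DIM('a) * (1/2) ^ k0"
      using that(1) by (intro mult_left_mono power_decreasing) auto
    also have "\<dots> < e"
      using k0 DIM_positive[where 'a = 'a] by (simp add: pos_less_divide_eq mult.commute)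
    finally show "y \<in> K" using x by (auto simp: K_def)
  qed
  have cube_sets: "dyadic_cube k z \<in> sets lebesgue" for k and z :: "'a \<Rightarrow> int"
    using dyadic_cube_lmeasurable by blast
  have hcube: "set_integrable lebesgue (dyadic_cube k z) h" if "k0 \<le> k" "z \<in> dyadic k ` E" for k z
    by (rule set_integrable_subset[OF hK cube_sets cubeK[OF that]])
  have a_ge: "((1/2) ^ k) ^ DIM('a) \<le> a k z" if "k0 \<le> k" "z \<in> dyadic k ` E" for k z
  proof -
    have "((1/2) ^ k) ^ DIM('a) = (LINT y|lebesgue. indicat_real (dyadic_cube k z) y)"
      using measure_dyadic_cube[of k z] by simp
    also have "\<dots> \<le> a k z"
      unfolding a_def set_lebesgue_integral_def
    proof (rule integral_mono)
      show "integrable lebesgue (indicat_real (dyadic_cube k z))"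
        using dyadic_cube_lmeasurable[of k z] by (auto simp: fmeasurable_def intro!: integrable_real_indicator)
      show "integrable lebesgue (\<lambda>y. indicat_real (dyadic_cube k z) y *\<^sub>R h y)"
        using hcube[OF that] by (simp add: set_integrable_def)
    qed (use hpos in \<open>auto split: split_indicator\<close>)
    finally show ?thesis .
  qed
  have "dyadic_energy E f a p C M k0"
  proof (unfold_locales)
    show "0 < C" using morrey_const_pos[OF p] by (simp add: C_def)
    show "bounded E" by (rule compact_imp_bounded[OF E(1)])
    show "dist (f x) (f y) \<le> C * ((1/2) ^ k) powr (1 - real DIM('a) / p) * a k (dyadic k x) powr (1 / p)"
      if k: "k0 \<le> k" and xy: "x \<in> E" "y \<in> E" "dyadic k x = dyadic k y" for k x y
      unfolding C_def
    proof (rule sobolev_dyadic_cube_bound[OF \<Omega> _ f(2) p g])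
      have z: "dyadic k x \<in> dyadic k ` E" using xy by blast
      show "dyadic_cube k (dyadic k x) \<subseteq> \<Omega>" using cubeK[OF k z] KO by blast
      show "0 < a k (dyadic k x)"
        using a_ge[OF k z] by (rule order_less_le_trans[rotated]) simp
      show "(LINT y:dyadic_cube k (dyadic k x)|lebesgue. \<bar>g j i y\<bar> powr p) \<le> a k (dyadic k x)"
        if i: "i \<in> Basis" for j i
        unfolding a_def
      proof (rule set_integral_mono)
        show "set_integrable lebesgue (dyadic_cube k (dyadic k x)) (\<lambda>y. \<bar>g j i y\<bar> powr p)"
          by (rule set_integrable_subset[OF gK[OF i] cube_sets cubeK[OF k z]])
      qed (use hcube[OF k z] g_le_h[OF i] in auto)
      show "x \<in> dyadic_cube k (dyadic k x)" by (rule self_mem_dyadic_cube)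
      show "y \<in> dyadic_cube k (dyadic k x)" unfolding xy(3) by (rule self_mem_dyadic_cube)
    qed
    show "(\<Sum>z\<in>dyadic k ` E. a k z) \<le> M" if k: "k0 \<le> k" for k
    proof -
      let ?Z = "dyadic k ` E"
      have fin: "finite ?Z" by (rule finite_dyadic_image[OF compact_imp_bounded[OF E(1)]])
      have int: "integrable lebesgue (\<lambda>y. indicat_real (dyadic_cube k z) y *\<^sub>R h y)" if "z \<in> ?Z" for z
        using hcube[OF k that] by (simp add: set_integrable_def)
      have "(\<Sum>z\<in>?Z. a k z) = (LINT y|lebesgue. (\<Sum>z\<in>?Z. indicat_real (dyadic_cube k z) y *\<^sub>R h y))"
        unfolding a_def set_lebesgue_integral_def
        by (rule Bochner_Integration.integral_sum[symmetric]) (rule int)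
      also have "\<dots> \<le> (LINT y|lebesgue. 3 ^ DIM('a) * (indicat_real K y *\<^sub>R h y))"
      proof (rule integral_mono)
        show "integrable lebesgue (\<lambda>y. \<Sum>z\<in>?Z. indicat_real (dyadic_cube k z) y *\<^sub>R h y)"
          by (intro Bochner_Integration.integrable_sum int)
        show "integrable lebesgue (\<lambda>y. 3 ^ DIM('a) * (indicat_real K y *\<^sub>R h y))"
          using hK by (simp add: set_integrable_def)
        show "(\<Sum>z\<in>?Z. indicat_real (dyadic_cube k z) y *\<^sub>R h y) \<le> 3 ^ DIM('a) * (indicat_real K y *\<^sub>R h y)" for y
        proof (cases "y \<in> K")
          case True
          have "(\<Sum>z\<in>?Z. indicat_real (dyadic_cube k z) y) \<le> 3 ^ DIM('a)"
            by (rule sum_indicator_dyadic_cube_le[OF fin]) (auto simp: dyadic_def)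
          then have "(\<Sum>z\<in>?Z. indicat_real (dyadic_cube k z) y) * h y \<le> 3 ^ DIM('a) * h y"
            using hpos[of y] by (intro mult_right_mono) auto
          then show ?thesis using True by (simp add: sum_distrib_right)
        next
          case False
          then have "y \<notin> dyadic_cube k z" if "z \<in> ?Z" for z using cubeK[OF k that] by blast
          then show ?thesis using False by simp
        qed
      qed
      also have "\<dots> \<le> M" by (simp add: M_def set_lebesgue_integral_def)
      finally show ?thesis .
    qed
  qed (use p M a_ge in auto)
  then show ?thesis by blast
qed

theorem theorem1p7:
  fixes \<Omega> E :: "(real ^ 'n) set"
    and f :: "real ^ 'n \<Rightarrow> real ^ 'm"
    and p :: real
  assumes "open \<Omega>" and "connected \<Omega>" and "\<Omega> \<noteq> {}"
    and "p > real CARD('n)"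
    and "f \<in> sobolev_W1_map p \<Omega>"
    and "continuous_on \<Omega> f"
    and "compact E" and "E \<subseteq> \<Omega>"
  shows "\<forall>\<theta>. 0 < \<theta> \<and> \<theta> < 1 \<longrightarrow>
    upper_intermediate_dim \<theta> (f ` E) \<le>
      p * upper_intermediate_dim \<theta> E / (p - real CARD('n) + upper_intermediate_dim \<theta> E)"
proof -
  have n: "real DIM(real ^ 'n) = real CARD('n)" by simp
  obtain a C M k0 where "dyadic_energy E f a p C M k0"
    using sobolev_dyadic_energy[OF assms(1) _ assms(5-8)] assms(4) unfolding n by blast
  from dyadic_energy.upper_intermediate_dim_image_le[OF this] show ?thesis
    unfolding n by blast
qed

end
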